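(* Let $\mathcal{G}=(B\cup I,E)$ be a bipartite graph with buyers $B$ and items $I$. For each edge $e=\{b,i\}$ let $D_e$ be a distribution over nonnegative reals, independent across edges; the reward $r_e\sim D_e$ is buyer $b$'s private value for item $i$, and a single sample $s_e\sim D_e$ is available, all drawn independently. Consider the following mechanism. Compute the greedy matching $M_S$ with respect to the samples (edges in non-increasing order of $s_e$, ties broken uniformly at random, adding an edge whenever the result is still a matching). For each $e=\{b,i\}\in M_S$ set $p_b=p_i=s_e$; for each vertex $k$ unmatched in $M_S$ set $p_k=0$. Start with $M=\emptyset$. Buyers arrive one at a time in an arbitrary (adversarial) order; when buyer $b$ arrives and reports her values, let $F(b)=\{e=\{b,i\}\in E: r_e\ge\max\{p_b,p_i\},\ i\text{ not matched in }M\}$; if $F(b)\neq\emptyset$, let $\tilde e=\{b,i^*\}$ maximize $r_e-\max\{p_b,p_i\}$ over $e\in F(b)$, add $\tilde e$ to $M$ with weight $r_{\tilde e}$, and charge buyer $b$ the price $\max\{p_b,p_{i^*}\}$. Then this mechanism is truthful (each buyer, whose utility is her value for the received item minus the price paid, maximizes her utility by reporting her true values), and for any arrival order $16\cdot\mathbb{E}[w(M)]\ge\mathbb{E}[\mathsf{OPT}]$, where $w(M)=\sum_{e\in M}r_e$ and $\mathsf{OPT}$ is the weight of a maximum-weight matching of $\mathcal{G}$ with respect to the true values $r_e$.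
   Context: Single-sample setting with one sample per edge distribution; buyers arrive online in adversarial order, items are available offline, and allocations are irrevocable.
   Formalization: The bound 16·E[w(M)] ≥ E[OPT] is proved only when every D_e is atomless (continuous); it fails for general D_e, since ties between a reward and a price can let a low-value buyer take an item. Truthfulness is proved for arbitrary distributions. *)

theory Defs
  imports "HOL-Probability.Probability"
begin

text \<open>
  A bipartite graph with buyers \<open>B\<close> and items \<open>I\<close> is given by its edge set \<open>E \<subseteq> B \<times> I\<close>; its vertices
  are \<open>Inl b\<close> for buyers and \<open>Inr i\<close> for items.
\<close>

fun ends :: "'b \<times> 'i \<Rightarrow> ('b + 'i) set" where
  "ends (b, i) = {Inl b, Inr i}"

definition matching :: "('b \<times> 'i) set \<Rightarrow> bool" where
  "matching M \<longleftrightarrow> (\<forall>e\<in>M. \<forall>f\<in>M. e \<noteq> f \<longrightarrow> ends e \<inter> ends f = {})"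

definition weight :: "('b \<times> 'i \<Rightarrow> real) \<Rightarrow> ('b \<times> 'i) set \<Rightarrow> real" where
  "weight r M = (\<Sum>e\<in>M. r e)"

definition opt :: "('b \<times> 'i) set \<Rightarrow> ('b \<times> 'i \<Rightarrow> real) \<Rightarrow> real" where
  "opt E r = Max (weight r ` {M. M \<subseteq> E \<and> matching M})"

definition greedy :: "('b \<times> 'i) list \<Rightarrow> ('b \<times> 'i) set" where
  "greedy es = fold (\<lambda>e M. if matching (insert e M) then insert e M else M) es {}"

text \<open>
  \<open>\<tau>\<close> is a list enumerating the edges. Since \<open>sort_key\<close> is stable, edges with equal samples are
  processed in the order in which they occur in \<open>\<tau>\<close>; a uniformly random enumeration \<open>\<tau>\<close> therefore
  amounts to breaking ties uniformly at random.
\<close>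

definition sample_matching :: "('b \<times> 'i \<Rightarrow> real) \<Rightarrow> ('b \<times> 'i) list \<Rightarrow> ('b \<times> 'i) set" where
  "sample_matching s \<tau> = greedy (sort_key (\<lambda>e. - s e) \<tau>)"

definition vertex_price ::
  "('b \<times> 'i \<Rightarrow> real) \<Rightarrow> ('b \<times> 'i) list \<Rightarrow> 'b + 'i \<Rightarrow> real" where
  "vertex_price s \<tau> k =
     (if \<exists>e\<in>sample_matching s \<tau>. k \<in> ends e
      then s (THE e. e \<in> sample_matching s \<tau> \<and> k \<in> ends e) else 0)"

fun edge_price :: "('b + 'i \<Rightarrow> real) \<Rightarrow> 'b \<times> 'i \<Rightarrow> real" where
  "edge_price p (b, i) = max (p (Inl b)) (p (Inr i))"

definition feasible ::
  "('b \<times> 'i) set \<Rightarrow> ('b + 'i \<Rightarrow> real) \<Rightarrow> ('b \<times> 'i \<Rightarrow> real) \<Rightarrow> ('b \<times> 'i) set \<Rightarrow> 'b \<Rightarrow> ('b \<times> 'i) set" where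
  "feasible E p r M b = {e \<in> E. fst e = b \<and> r e \<ge> edge_price p e \<and> snd e \<notin> snd ` M}"

definition best_edges ::
  "('b \<times> 'i) set \<Rightarrow> ('b + 'i \<Rightarrow> real) \<Rightarrow> ('b \<times> 'i \<Rightarrow> real) \<Rightarrow> ('b \<times> 'i) set \<Rightarrow> 'b \<Rightarrow> ('b \<times> 'i) set" where
  "best_edges E p r M b =
     {e. is_arg_max (\<lambda>e. r e - edge_price p e) (\<lambda>e. e \<in> feasible E p r M b) e}"

text \<open>
  The state of the mechanism is the current matching together with the amount charged to each buyer.
  The parameter \<open>sel\<close> selects one of several surplus-maximizing edges; it may use the current
  matching and the set of maximizers (and hence the identity of the arriving buyer).
\<close>

type_synonym ('b, 'i) outcome = "('b \<times> 'i) set \<times> ('b \<Rightarrow> real)"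

definition serve_buyer ::
  "(('b \<times> 'i) set \<Rightarrow> ('b \<times> 'i) set \<Rightarrow> 'b \<times> 'i) \<Rightarrow> ('b \<times> 'i) set \<Rightarrow> ('b + 'i \<Rightarrow> real) \<Rightarrow>
   ('b \<times> 'i \<Rightarrow> real) \<Rightarrow> 'b \<Rightarrow> ('b, 'i) outcome \<Rightarrow> ('b, 'i) outcome" where
  "serve_buyer sel E p r b = (\<lambda>(M, c).
     if feasible E p r M b = {} then (M, c)
     else let e = sel M (best_edges E p r M b)
          in (insert e M, c(b := edge_price p e)))"

definition mechanism ::
  "(('b \<times> 'i) set \<Rightarrow> ('b \<times> 'i) set \<Rightarrow> 'b \<times> 'i) \<Rightarrow> ('b \<times> 'i) set \<Rightarrow> 'b list \<Rightarrow>
   ('b \<times> 'i \<Rightarrow> real) \<Rightarrow> ('b \<times> 'i) list \<Rightarrow> ('b \<times> 'i \<Rightarrow> real) \<Rightarrow> ('b, 'i) outcome" where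
  "mechanism sel E arrivals s \<tau> r =
     fold (serve_buyer sel E (vertex_price s \<tau>) r) arrivals ({}, \<lambda>_. 0)"

definition utility :: "('b \<times> 'i \<Rightarrow> real) \<Rightarrow> 'b \<Rightarrow> ('b, 'i) outcome \<Rightarrow> real" where
  "utility v b = (\<lambda>(M, c). (\<Sum>e\<in>{e \<in> M. fst e = b}. v e) - c b)"

text \<open>
  Dominant-strategy truthfulness of a map from reported values to outcomes. In \<open>v\<close> the edges at \<open>b\<close>
  carry the true values of \<open>b\<close> and the other edges the arbitrary reports of the other buyers; \<open>v'\<close>
  differs from \<open>v\<close> only in the report of \<open>b\<close>.
\<close>

definition truthful ::
  "'b set \<Rightarrow> ('b \<times> 'i) set \<Rightarrow> (('b \<times> 'i \<Rightarrow> real) \<Rightarrow> ('b, 'i) outcome) \<Rightarrow> bool" where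
  "truthful B E mech \<longleftrightarrow>
     (\<forall>b\<in>B. \<forall>v v'. (\<forall>e\<in>E. 0 \<le> v e \<and> 0 \<le> v' e) \<longrightarrow> (\<forall>e\<in>E. fst e \<noteq> b \<longrightarrow> v' e = v e) \<longrightarrow>
        utility v b (mech v') \<le> utility v b (mech v))"

text \<open>
  The joint law of the samples, the rewards and the tie-breaking enumeration of the edges.

  A competitive guarantee with respect to this law needs atomless distributions, because the
  acceptance rule does not break ties between a reward and a price: take one item, a first buyer with
  constant value 1 and a second buyer with value 10000 with probability 1/100 and 0 otherwise. The
  expected weight obtained is 1.99, while the expected optimum is 100.99.
\<close>

definition joint_law ::
  "('b \<times> 'i) set \<Rightarrow> ('b \<times> 'i \<Rightarrow> real measure) \<Rightarrow>
   (('b \<times> 'i \<Rightarrow> real) \<times> ('b \<times> 'i \<Rightarrow> real) \<times> ('b \<times> 'i) list) measure" where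
  "joint_law E D =
     Pi\<^sub>M E D \<Otimes>\<^sub>M (Pi\<^sub>M E D \<Otimes>\<^sub>M uniform_count_measure (permutations_of_set E))"

end

theory Submission
  imports Defs
begin

text \<open>
  Truthfulness holds because the prices do not depend on the reports and a buyer is offered her
  favourite edge at these prices.

  For the guarantee, draw two values for every edge and let independent fair coins decide which of
  the two is the sample; it then suffices to fix the values and average over the coins. Run through
  all values in decreasing order and build \<open>M\<close>, the greedy matching of the samples, and \<open>F\<close>, the set
  of edges whose reward beats the prices: a value whose edge \<open>e\<close> has both endpoints unmatched in \<open>M\<close>
  puts \<open>e\<close> into \<open>M\<close> if it is a sample and into \<open>F\<close> if it is a reward. The mechanism outputs a maximal
  matching of \<open>F\<close>. Call \<open>g \<in> F\<close> last if its reward is minimal in \<open>F\<close> at both of its endpoints. The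
  last edges and the edges of \<open>M \<inter> F\<close> that meet no last edge form a matching, and every edge of it
  meets an edge of the output of at least the same value, so the output has at least half the weight
  of this matching. A potential that only grows on average shows that the expected weight of this
  matching is at least a quarter of that of \<open>M\<close>, which is at least half of the optimum for the samples.
\<close>

section \<open>Matchings\<close>

lemma finite_ends [simp]: "finite (ends e)"
  by (cases e) simp

lemma card_ends [simp]: "card (ends e) = 2"
  by (cases e) simp

definition meets :: "'b \<times> 'i \<Rightarrow> 'b \<times> 'i \<Rightarrow> bool" where
  "meets e f \<longleftrightarrow> ends e \<inter> ends f \<noteq> {}"

lemma meets_iff: "meets e f \<longleftrightarrow> fst e = fst f \<or> snd e = snd f"
  by (cases e; cases f) (auto simp: meets_def)

lemma meets_self [simp]: "meets e e"
  by (simp add: meets_iff)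

lemma meets_sym: "meets e f \<longleftrightarrow> meets f e"
  by (auto simp: meets_iff)

lemma matching_iff_meets: "matching M \<longleftrightarrow> (\<forall>e\<in>M. \<forall>f\<in>M. meets e f \<longrightarrow> e = f)"
  unfolding matching_def meets_def by blast

lemma matching_meetsD: "matching M \<Longrightarrow> e \<in> M \<Longrightarrow> f \<in> M \<Longrightarrow> meets e f \<Longrightarrow> e = f"
  unfolding matching_iff_meets by blast

lemma matching_insert_iff:
  assumes "matching M"
  shows "matching (insert e M) \<longleftrightarrow> (\<forall>f\<in>M. f \<noteq> e \<longrightarrow> \<not> meets f e)"
proof -
  have "(\<forall>f\<in>M. meets e f \<longrightarrow> e = f) \<longleftrightarrow> (\<forall>f\<in>M. f \<noteq> e \<longrightarrow> \<not> meets f e)"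
    using meets_sym by metis
  moreover have "(\<forall>f\<in>M. meets f e \<longrightarrow> f = e) \<longleftrightarrow> (\<forall>f\<in>M. f \<noteq> e \<longrightarrow> \<not> meets f e)"
    by blast
  ultimately show ?thesis using assms unfolding matching_iff_meets by simp
qed

text \<open>An edge has only two endpoints. Picking for every member of \<open>A\<close> that meets
  \<open>n\<close> a shared endpoint is injective, because two members sharing an endpoint
  coincide.\<close>

lemma card_matching_meets_le:
  assumes "matching A"
  shows "card {e\<in>A. meets e n} \<le> 2"
proof -
  define h where "h e = (SOME k. k \<in> ends e \<inter> ends n)" for e
  have h: "h e \<in> ends e \<inter> ends n" if "meets e n" for e
  proof -
    have "\<exists>k. k \<in> ends e \<inter> ends n" using that unfolding meets_def by blast
    then show ?thesis unfolding h_def by (rule someI_ex)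
  qed
  have "inj_on h {e\<in>A. meets e n}"
  proof (rule inj_onI)
    fix e f assume *: "e \<in> {e\<in>A. meets e n}" "f \<in> {e\<in>A. meets e n}" "h e = h f"
    then have "meets e f" using h[of e] h[of f] by (auto simp: meets_def)
    then show "e = f" using matching_meetsD[OF assms] * by blast
  qed
  moreover have "h ` {e\<in>A. meets e n} \<subseteq> ends n" using h by auto
  ultimately show ?thesis using card_inj_on_le[of h _ "ends n"] by simp
qed

text \<open>Charge every edge of \<open>A\<close> to an edge of \<open>N\<close> that meets it and
  is worth at least as much; no edge of \<open>N\<close> is charged more than twice. This factor 2
  enters the proof twice: for greedy against the optimum and for the output against the matching of
  last and unmet edges.\<close>

lemma matching_charge:
  fixes y z :: "'b \<times> 'i \<Rightarrow> real"
  assumes "finite A" "finite N" "matching A"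
    and z: "\<And>n. n \<in> N \<Longrightarrow> 0 \<le> z n"
    and ex: "\<And>e. e \<in> A \<Longrightarrow> \<exists>n\<in>N. meets e n \<and> y e \<le> z n"
  shows "sum y A \<le> 2 * sum z N"
proof -
  have "sum y A \<le> (\<Sum>e\<in>A. \<Sum>n\<in>N. if meets e n then z n else 0)"
  proof (rule sum_mono)
    fix e assume "e \<in> A"
    then obtain n where n: "n \<in> N" "meets e n" "y e \<le> z n" using ex by blast
    have "(if meets e n then z n else 0) \<le> (\<Sum>n\<in>N. if meets e n then z n else 0)"
      by (rule member_le_sum) (use n z assms in auto)
    then show "y e \<le> (\<Sum>n\<in>N. if meets e n then z n else 0)" using n by auto
  qed
  also have "\<dots> = (\<Sum>n\<in>N. \<Sum>e\<in>A. if meets e n then z n else 0)"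
    by (rule sum.swap)
  also have "\<dots> = (\<Sum>n\<in>N. real (card {e\<in>A. meets e n}) * z n)"
    using assms(1) by (intro sum.cong refl) (simp add: sum.If_cases Int_def)
  also have "\<dots> \<le> (\<Sum>n\<in>N. 2 * z n)"
  proof (intro sum_mono mult_right_mono)
    show "real (card {e\<in>A. meets e n}) \<le> 2" for n
      using card_matching_meets_le[OF assms(3), of n] by linarith
  qed (use z in auto)
  finally show ?thesis by (simp add: sum_distrib_left)
qed

section \<open>Greedy matchings as stable matchings\<close>

text \<open>A description of greedy matchings that does not mention a processing order. It allows
  the sorting-based matching of the mechanism to be identified with the one built by the coin
  process.\<close>

definition stable_matching :: "('b \<times> 'i) set \<Rightarrow> ('b \<times> 'i \<Rightarrow> real) \<Rightarrow> ('b \<times> 'i) set \<Rightarrow> bool" where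
  "stable_matching E s M \<longleftrightarrow>
     M \<subseteq> E \<and> matching M \<and> (\<forall>e\<in>E. \<exists>f\<in>M. meets f e \<and> s e \<le> s f)"

text \<open>Take the edge of largest value in the symmetric difference. The matching that lacks it
  contains a blocking edge of at least the same value. By maximality and injectivity the blocker
  also lies in the other matching, where it meets the chosen edge: a contradiction.\<close>

lemma stable_matching_unique:
  assumes "finite E" "inj_on s E" "stable_matching E s M" "stable_matching E s N"
  shows "M = N"
proof (rule ccontr)
  assume "M \<noteq> N"
  define X where "X = (M - N) \<union> (N - M)"
  have X: "finite X" "X \<noteq> {}" "X \<subseteq> E"
    using assms \<open>M \<noteq> N\<close> unfolding X_def stable_matching_def by (auto intro: finite_subset)
  have "Max (s ` X) \<in> s ` X" using X by (intro Max_in) auto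
  then obtain e where "e \<in> X" "s e = Max (s ` X)" by (metis imageE)
  then have e: "e \<in> X" "\<And>y. y \<in> X \<Longrightarrow> s y \<le> s e"
    using X(1) by auto
  \<comment> \<open>The roles of \<open>M\<close> and \<open>N\<close> are symmetric:
    \<open>P\<close> is the matching that contains \<open>e\<close>, and \<open>Q\<close> is the one
    that lacks it.\<close>
  have *: False if "e \<in> P" "e \<notin> Q" and P: "P \<subseteq> E" "matching P"
    and Q: "Q \<subseteq> E" "\<forall>e\<in>E. \<exists>f\<in>Q. meets f e \<and> s e \<le> s f"
    and PQ: "Q - P \<subseteq> X" for P Q
  proof -
    have "e \<in> E" using that(1) P(1) by auto
    then obtain f where f: "f \<in> Q" "meets f e" "s e \<le> s f" using Q(2) by auto
    have "f \<in> P"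
    proof (rule ccontr)
      assume "f \<notin> P"
      then have "s f \<le> s e" using f(1) PQ e(2)[of f] by auto
      then have "s f = s e" using f(3) by simp
      moreover have "f \<in> E" using f(1) Q(1) by auto
      ultimately have "f = e" using \<open>e \<in> E\<close> assms(2) by (auto dest: inj_onD)
      then show False using f(1) that(2) by simp
    qed
    then have "f = e" using P(2) f(2) that(1) matching_meetsD by metis
    then show False using f(1) that(2) by simp
  qed
  have MN: "M \<subseteq> E" "matching M" "\<forall>e\<in>E. \<exists>f\<in>M. meets f e \<and> s e \<le> s f"
     "N \<subseteq> E" "matching N" "\<forall>e\<in>E. \<exists>f\<in>N. meets f e \<and> s e \<le> s f"
    using assms(3,4) unfolding stable_matching_def by auto
  from e(1) consider "e \<in> M" "e \<notin> N" | "e \<in> N" "e \<notin> M" unfolding X_def by auto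
  then show False
  proof cases
    case 1
    then show False by (rule *) (use MN in \<open>auto simp: X_def\<close>)
  next
    case 2
    then show False by (rule *) (use MN in \<open>auto simp: X_def\<close>)
  qed
qed

text \<open>The edge processed last has the smallest sample, so if it is rejected, the accepted edge
  that it meets has at least the same sample.\<close>

lemma greedy_stable:
  fixes s :: "'b \<times> 'i \<Rightarrow> real"
  assumes "sorted_wrt (\<lambda>e f. s f \<le> s e) es"
  shows "stable_matching (set es) s (greedy es)"
  using assms
proof (induction es rule: rev_induct)
  case Nil
  then show ?case by (simp add: greedy_def stable_matching_def matching_def)
next
  case (snoc e es)
  define M where "M = greedy es"
  have IH: "M \<subseteq> set es" "matching M" "\<And>e. e\<in>set es \<Longrightarrow> \<exists>f\<in>M. meets f e \<and> s e \<le> s f"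
    using snoc unfolding stable_matching_def M_def by (auto simp: sorted_wrt_append)
  have le: "s e \<le> s f" if "f \<in> M" for f
    using snoc.prems that IH(1) by (auto simp: sorted_wrt_append)
  have G: "greedy (es @ [e]) = (if matching (insert e M) then insert e M else M)"
    by (simp add: greedy_def M_def)
  show ?case
  proof (cases "matching (insert e M)")
    case True
    then show ?thesis using IH G unfolding stable_matching_def by fastforce
  next
    case False
    then obtain f where "f \<in> M" "meets f e" using matching_insert_iff[OF IH(2)] by blast
    then show ?thesis using IH G False le unfolding stable_matching_def by auto
  qed
qed

lemma sample_matching_stable:
  assumes "set \<tau> = E"
  shows "stable_matching E s (sample_matching s \<tau>)"
proof -
  have "sorted (map (\<lambda>e. - s e) (sort_key (\<lambda>e. - s e) \<tau>))" by simp
  then have "sorted_wrt (\<lambda>e f. s f \<le> s e) (sort_key (\<lambda>e. - s e) \<tau>)"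
    unfolding sorted_wrt_map by simp
  from greedy_stable[OF this] show ?thesis by (simp add: sample_matching_def assms)
qed

section \<open>The potential\<close>

text \<open>
  The cover factor of \<open>g\<close> is a lower bound for the chance that \<open>g\<close> stays last, since the next value
  that matters at an uncovered endpoint is a sample with probability at least one half.
  A coin flip for a fresh edge \<open>e\<close> destroys, if it comes up reward, the last edges meeting \<open>e\<close>, and
  doubles their cover factor if it comes up sample; this makes the first sum of the potential balance
  on average. If both values of an edge matter, the second one is a sample without a coin flip. It is
  paid for by the last edges that it meets or, if there are none, by the second sum.
\<close>

definition last_cands :: "('b \<times> 'i) set \<Rightarrow> ('b \<times> 'i \<Rightarrow> real) \<Rightarrow> ('b \<times> 'i) set" where
  "last_cands F r = {g\<in>F. \<forall>f\<in>F. meets f g \<longrightarrow> r g \<le> r f}"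

definition cover_factor :: "('b \<times> 'i) set \<Rightarrow> 'b \<times> 'i \<Rightarrow> real" where
  "cover_factor M g = 2 ^ card (ends g \<inter> \<Union>(ends ` M)) / 4"

definition unmet :: "('b \<times> 'i) set \<Rightarrow> ('b \<times> 'i) set \<Rightarrow> ('b \<times> 'i \<Rightarrow> real) \<Rightarrow> ('b \<times> 'i) set" where
  "unmet M F r = {f\<in>M \<inter> F. \<forall>g\<in>last_cands F r. \<not> meets g f}"

text \<open>The potential starts at 0, so a nonnegative average at the end says that the last and
  unmet edges together earn on average at least a quarter of the greedy matching; the last summand
  encodes this quarter.\<close>

definition potential ::
  "('b \<times> 'i \<Rightarrow> real) \<Rightarrow> ('b \<times> 'i \<Rightarrow> real) \<Rightarrow> ('b \<times> 'i) set \<times> ('b \<times> 'i) set \<Rightarrow> real" where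
  "potential s r = (\<lambda>(M, F). (\<Sum>g\<in>last_cands F r. cover_factor M g * r g)
      + sum s (unmet M F r) - sum s M / 4)"

lemma cover_factor_ge: "1 / 4 \<le> cover_factor M g"
  unfolding cover_factor_def by simp

lemma cover_factor_le: "cover_factor M g \<le> 1"
proof -
  have "card (ends g \<inter> \<Union>(ends ` M)) \<le> card (ends g)" by (intro card_mono) auto
  then have "(2::real) ^ card (ends g \<inter> \<Union>(ends ` M)) \<le> 2 ^ 2"
    by (intro power_increasing) auto
  then show ?thesis unfolding cover_factor_def by simp
qed

text \<open>No endpoint of \<open>e\<close> was covered before, so an endpoint that \<open>g\<close>
  shares with \<open>e\<close> is newly covered and contributes a factor 2.\<close>

lemma cover_factor_insert:
  assumes "\<forall>f\<in>M. \<not> meets f e"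
  shows "cover_factor (insert e M) g \<ge> (if meets g e then 2 else 1) * cover_factor M g"
proof -
  let ?A = "ends g \<inter> \<Union>(ends ` M)"
  let ?A' = "ends g \<inter> \<Union>(ends ` insert e M)"
  have "?A' = ?A \<union> (ends g \<inter> ends e)" by auto
  moreover have "?A \<inter> (ends g \<inter> ends e) = {}" using assms by (auto simp: meets_def)
  ultimately have "card ?A' = card ?A + card (ends g \<inter> ends e)"
    by (simp add: card_Un_disjoint)
  moreover have "card (ends g \<inter> ends e) \<ge> (if meets g e then 1 else 0)"
    by (auto simp: Suc_le_eq card_gt_0_iff meets_def)
  ultimately have "card ?A' \<ge> card ?A + (if meets g e then 1 else 0)" by linarith
  then have "(2::real) ^ (card ?A + (if meets g e then 1 else 0)) \<le> 2 ^ card ?A'"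
    by (intro power_increasing) auto
  moreover have "(2::real) ^ (card ?A + (if meets g e then 1 else 0))
      = (if meets g e then 2 else 1) * 2 ^ card ?A"
    by simp
  ultimately show ?thesis unfolding cover_factor_def by linarith
qed

text \<open>The last edges depend on \<open>F\<close> only and stay the same. Those that meet
  \<open>e\<close> at least double their cover factor, and \<open>e\<close> is the only edge that
  can become newly unmet.\<close>

lemma potential_sample:
  assumes fin: "finite M" "finite F" and free: "\<forall>f\<in>M. \<not> meets f e"
    and r: "\<forall>g\<in>F. 0 \<le> r g" and s: "0 \<le> s e"
  shows "potential s r (insert e M, F) \<ge> potential s r (M, F)
    + (\<Sum>g\<in>{g\<in>last_cands F r. meets g e}. cover_factor M g * r g)
    + (if e \<in> unmet (insert e M) F r then s e else 0) - s e / 4"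
proof -
  have e: "e \<notin> M" using free by auto
  let ?L = "last_cands F r"
  have L: "finite ?L" "?L \<subseteq> F" using fin by (auto simp: last_cands_def)
  have "(\<Sum>g\<in>?L. cover_factor M g * r g) + (\<Sum>g\<in>{g\<in>?L. meets g e}. cover_factor M g * r g)
      = (\<Sum>g\<in>?L. (if meets g e then 2 else 1) * cover_factor M g * r g)"
    unfolding sum.inter_filter[OF L(1)] sum.distrib[symmetric]
    by (intro sum.cong) auto
  also have "\<dots> \<le> (\<Sum>g\<in>?L. cover_factor (insert e M) g * r g)"
    using L r by (intro sum_mono mult_right_mono cover_factor_insert[OF free]) auto
  finally have 1: "(\<Sum>g\<in>?L. cover_factor M g * r g)
      + (\<Sum>g\<in>{g\<in>?L. meets g e}. cover_factor M g * r g)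
      \<le> (\<Sum>g\<in>?L. cover_factor (insert e M) g * r g)" .
  have U: "unmet (insert e M) F r = (if e \<in> unmet (insert e M) F r
     then insert e (unmet M F r) else unmet M F r)"
    by (rule set_eqI) (simp add: unmet_def, blast)
  have "e \<notin> unmet M F r" "finite (unmet M F r)" using e fin by (auto simp: unmet_def)
  then have 2: "sum s (unmet (insert e M) F r)
     = sum s (unmet M F r) + (if e \<in> unmet (insert e M) F r then s e else 0)"
    by (subst U) simp
  have 3: "sum s (insert e M) = s e + sum s M" using e fin by simp
  show ?thesis using 1 2 unfolding potential_def prod.case 3 add_divide_distrib by linarith
qed

text \<open>The reward of \<open>e\<close> is the smallest so far. Hence \<open>e\<close> becomes
  last, with cover factor 1/4 as both its endpoints are uncovered, and exactly the last edges that
  meet \<open>e\<close> cease to be last.\<close>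

lemma potential_reward:
  assumes fin: "finite M" "finite F" and free: "\<forall>f\<in>M. \<not> meets f e"
    and e: "e \<notin> F" and less: "\<forall>f\<in>F. r e < r f" and s: "\<forall>f\<in>M. 0 \<le> s f"
  shows "potential s r (M, insert e F) \<ge> potential s r (M, F)
    - (\<Sum>g\<in>{g\<in>last_cands F r. meets g e}. cover_factor M g * r g) + r e / 4"
proof -
  let ?L = "last_cands F r"
  have L: "finite ?L" "?L \<subseteq> F" using fin by (auto simp: last_cands_def)
  have L': "last_cands (insert e F) r = insert e {g\<in>?L. \<not> meets g e}"
  proof (rule set_eqI)
    fix g
    have "meets g e \<longleftrightarrow> meets e g" by (rule meets_sym)
    then show "g \<in> last_cands (insert e F) r \<longleftrightarrow> g \<in> insert e {g\<in>?L. \<not> meets g e}"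
      using less e unfolding last_cands_def
      by (cases "g = e") (auto simp: not_le intro: less_imp_le)
  qed
  have e': "cover_factor M e = 1 / 4"
  proof -
    have "ends e \<inter> \<Union>(ends ` M) = {}" using free by (auto simp: meets_def)
    then show ?thesis by (simp add: cover_factor_def)
  qed
  have "(\<Sum>g\<in>last_cands (insert e F) r. cover_factor M g * r g)
     = r e / 4 + (\<Sum>g\<in>{g\<in>?L. \<not> meets g e}. cover_factor M g * r g)"
  proof -
    have "finite {g\<in>?L. \<not> meets g e}" "e \<notin> {g\<in>?L. \<not> meets g e}" using L e by auto
    then show ?thesis unfolding L' using e' by simp
  qed
  moreover have "(\<Sum>g\<in>?L. cover_factor M g * r g)
     = (\<Sum>g\<in>{g\<in>?L. \<not> meets g e}. cover_factor M g * r g)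
       + (\<Sum>g\<in>{g\<in>?L. meets g e}. cover_factor M g * r g)"
  proof -
    have "?L = {g\<in>?L. \<not> meets g e} \<union> {g\<in>?L. meets g e}" by blast
    moreover have "sum h ({g\<in>?L. \<not> meets g e} \<union> {g\<in>?L. meets g e})
      = sum h {g\<in>?L. \<not> meets g e} + sum h {g\<in>?L. meets g e}" for h :: "'a \<times> 'b \<Rightarrow> real"
      using L(1) by (intro sum.union_disjoint) auto
    ultimately show ?thesis by metis
  qed
  moreover have "sum s (unmet M F r) \<le> sum s (unmet M (insert e F) r)"
  proof (rule sum_mono2)
    show "finite (unmet M (insert e F) r)" using fin by (auto simp: unmet_def)
    \<comment> \<open>The only new last edge is \<open>e\<close>, and it meets no edge of
      \<open>M\<close>.\<close>
    show "unmet M F r \<subseteq> unmet M (insert e F) r"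
    proof
      fix f assume f: "f \<in> unmet M F r"
      then have "\<not> meets e f" using free meets_sym[of e f] by (simp add: unmet_def)
      then show "f \<in> unmet M (insert e F) r" using f unfolding unmet_def L' by simp
    qed
  qed (use s in \<open>auto simp: unmet_def\<close>)
  ultimately show ?thesis unfolding potential_def prod.case by linarith
qed

section \<open>Averaging over the coins\<close>

text \<open>The coins are encoded by the set \<open>C\<close>: for \<open>e \<in> C\<close> the
  value tagged \<open>True\<close> is the reward and the one tagged \<open>False\<close> the sample,
  otherwise conversely. Restricting to \<open>E\<close> yields points of the product space
  \<open>Pi\<^sub>M E D\<close>.\<close>

definition coin_sample :: "('b \<times> 'i) set \<Rightarrow> (('b \<times> 'i) \<times> bool \<Rightarrow> real) \<Rightarrow> ('b \<times> 'i) set \<Rightarrow> 'b \<times> 'i \<Rightarrow> real" where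
  "coin_sample E v C = (\<lambda>e\<in>E. v (e, e \<notin> C))"

definition coin_reward :: "('b \<times> 'i) set \<Rightarrow> (('b \<times> 'i) \<times> bool \<Rightarrow> real) \<Rightarrow> ('b \<times> 'i) set \<Rightarrow> 'b \<times> 'i \<Rightarrow> real" where
  "coin_reward E v C = (\<lambda>e\<in>E. v (e, e \<in> C))"

lemma coin_sample_apply [simp]: "e \<in> E \<Longrightarrow> coin_sample E v C e = v (e, e \<notin> C)"
  by (simp add: coin_sample_def)

lemma coin_reward_apply [simp]: "e \<in> E \<Longrightarrow> coin_reward E v C e = v (e, e \<in> C)"
  by (simp add: coin_reward_def)

text \<open>The value tagged \<open>\<beta>\<close> is the sample of \<open>e\<close> exactly if
  \<open>\<beta> = (e \<notin> C)\<close>. In a decreasing run, a value whose edge meets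
  \<open>M\<close> has no effect: as a sample it is rejected by greedy, as a reward it lies below a
  price.\<close>

fun coin_step :: "('b \<times> 'i) set \<Rightarrow> ('b \<times> 'i) \<times> bool \<Rightarrow>
    ('b \<times> 'i) set \<times> ('b \<times> 'i) set \<Rightarrow> ('b \<times> 'i) set \<times> ('b \<times> 'i) set" where
  "coin_step C (e, \<beta>) (M, F) =
     (if \<exists>f\<in>M. meets f e then (M, F)
      else if \<beta> = (e \<notin> C) then (insert e M, F) else (M, insert e F))"

definition coin_run :: "('b \<times> 'i) set \<Rightarrow> (('b \<times> 'i) \<times> bool) list \<Rightarrow> ('b \<times> 'i) set \<times> ('b \<times> 'i) set" where
  "coin_run C xs = fold (coin_step C) xs ({}, {})"

lemma coin_run_Nil [simp]: "coin_run C [] = ({}, {})"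
  by (simp add: coin_run_def)

lemma coin_run_snoc [simp]: "coin_run C (xs @ [x]) = coin_step C x (coin_run C xs)"
  by (simp add: coin_run_def)

text \<open>Only the coins of edges already seen matter, so the coin of a fresh edge can be flipped
  without changing the history.\<close>

lemma coin_run_cong:
  "C \<inter> fst ` set xs = C' \<inter> fst ` set xs \<Longrightarrow> coin_run C xs = coin_run C' xs"
proof (induction xs rule: rev_induct)
  case (snoc x xs)
  obtain e \<beta> where x: "x = (e, \<beta>)" by (cases x)
  have "coin_run C xs = coin_run C' xs" using snoc by (intro snoc.IH) auto
  moreover have "e \<in> C \<longleftrightarrow> e \<in> C'" using snoc.prems x by auto
  ultimately show ?case by (cases "coin_run C' xs") (simp add: x)
qed simp

text \<open>At any time \<open>M\<close> is stable for the samples seen so far, and \<open>F\<close>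
  consists of the rewards seen so far that beat the prices set by the current \<open>M\<close>.
  Edges never have to leave \<open>F\<close>, because an edge entering \<open>M\<close> later has a
  smaller sample than every reward already seen.\<close>

lemma coin_run_invariant:
  assumes "sorted_wrt (\<lambda>x y. v y < v x) xs" "fst ` set xs \<subseteq> E" "coin_run C xs = (M, F)"
  defines "s \<equiv> coin_sample E v C" and "r \<equiv> coin_reward E v C"
  shows "M \<subseteq> {e. (e, e \<notin> C) \<in> set xs} \<and> matching M
    \<and> (\<forall>e. (e, e \<notin> C) \<in> set xs \<longrightarrow> (\<exists>f\<in>M. meets f e \<and> s e \<le> s f))
    \<and> F = {e. (e, e \<in> C) \<in> set xs \<and> (\<forall>f\<in>M. meets f e \<longrightarrow> s f < r e)}"
  using assms(1-3)
proof (induction xs arbitrary: M F rule: rev_induct)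
  case Nil
  then show ?case by (auto simp: matching_def)
next
  case (snoc x xs)
  obtain e \<beta> where x: "x = (e, \<beta>)" by (cases x)
  obtain M0 F0 where run: "coin_run C xs = (M0, F0)" by (cases "coin_run C xs")
  have e: "e \<in> E" using snoc.prems(2) x by auto
  have E: "f \<in> E" if "(f, \<gamma>) \<in> set xs" for f \<gamma> using snoc.prems(2) that by force
  \<comment> \<open>The current value is strictly below all earlier ones; this decides every
    comparison below.\<close>
  have less: "v (e, \<beta>) < v (f, \<gamma>)" if "(f, \<gamma>) \<in> set xs" for f \<gamma>
    using snoc.prems(1) that x by (auto simp: sorted_wrt_append)
  then have new: "(e, \<beta>) \<notin> set xs" by blast
  have "sorted_wrt (\<lambda>x y. v y < v x) xs" "fst ` set xs \<subseteq> E"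
    using snoc.prems(1,2) by (auto simp: sorted_wrt_append)
  note IH = snoc.IH[OF this run]
  have M0: "(f, f \<notin> C) \<in> set xs" "f \<in> E" "s f = v (f, f \<notin> C)" "v (e, \<beta>) < s f" if "f \<in> M0" for f
  proof -
    show 1: "(f, f \<notin> C) \<in> set xs" using IH that by blast
    show 2: "f \<in> E" using E 1 by blast
    show 3: "s f = v (f, f \<notin> C)" using 2 by (simp add: s_def)
    show "v (e, \<beta>) < s f" using less[OF 1] 3 by simp
  qed
  have ms: "matching M0" using IH by blast
  have blk: "\<exists>f\<in>M0. meets f g \<and> s g \<le> s f" if "(g, g \<notin> C) \<in> set xs" for g using IH that by blast
  have F0: "F0 = {e. (e, e \<in> C) \<in> set xs \<and> (\<forall>f\<in>M0. meets f e \<longrightarrow> s f < r e)}" using IH by blast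
  have step: "(M, F) = coin_step C (e, \<beta>) (M0, F0)" using snoc.prems(3) run x by simp
  show ?case
  proof (cases "\<exists>f\<in>M0. meets f e")
    case True
    then obtain f where f: "f \<in> M0" "meets f e" by auto
    have MF: "M = M0" "F = F0" using step True by auto
    \<comment> \<open>The blocking edge \<open>f\<close> covers \<open>e\<close> if the value is a
      sample and keeps \<open>e\<close> out of \<open>F\<close> if it is a reward.\<close>
    have "s e \<le> s f" if "\<beta> = (e \<notin> C)"
      using M0(4)[OF f(1)] e that by (simp add: s_def)
    moreover have "\<not> s f < r e" if "\<beta> = (e \<in> C)"
      using M0(4)[OF f(1)] e that by (simp add: r_def)
    ultimately show ?thesis
      unfolding MF x using IH f by auto
  next
    case free: False
    show ?thesis
    proof (cases "\<beta> = (e \<notin> C)")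
      case True
      then have MF: "M = insert e M0" "F = F0" using step free by auto
      have "matching M" unfolding MF matching_insert_iff[OF ms] using free by auto
      \<comment> \<open>The new price set by \<open>e\<close> lies below all rewards already seen,
        so it removes nothing from \<open>F0\<close>.\<close>
      moreover have "F0 = {g. (g, g \<in> C) \<in> set (xs @ [x]) \<and> (\<forall>f\<in>M. meets f g \<longrightarrow> s f < r g)}"
      proof -
        have "s e < r g" if "(g, g \<in> C) \<in> set xs" for g
          using less[OF that] E[OF that] True e by (simp add: s_def r_def)
        moreover have "(g, g \<in> C) \<noteq> x" for g using True x by auto
        ultimately show ?thesis unfolding F0 MF by auto
      qed
      ultimately show ?thesis using M0(1) blk True unfolding MF x by auto
    next
      case False
      then have MF: "M = M0" "F = insert e F0" using step free by auto
      have "(g, g \<notin> C) \<noteq> x" for g using False x by auto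
      moreover have "(g, g \<in> C) = x \<longleftrightarrow> g = e" for g using False x by auto
      ultimately show ?thesis using IH free unfolding MF by auto
    qed
  qed
qed

text \<open>Pairs the coin sets that differ only in the coin of \<open>e\<close>.\<close>

lemma sum_Pow_remove:
  fixes h :: "'a set \<Rightarrow> real"
  assumes "finite E" "e \<in> E"
  shows "(\<Sum>C\<in>Pow E. h C) = (\<Sum>C\<in>Pow (E - {e}). h C + h (insert e C))"
proof -
  have "Pow E = Pow (E - {e}) \<union> insert e ` Pow (E - {e})"
    using assms(2) Pow_insert[of e "E - {e}"] by (simp add: insert_absorb)
  moreover have "Pow (E - {e}) \<inter> insert e ` Pow (E - {e}) = {}" by auto
  moreover have "inj_on (insert e) (Pow (E - {e}))" by (auto simp: inj_on_def)
  ultimately show ?thesis using assms(1)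
    by (simp add: sum.union_disjoint sum.reindex sum.distrib)
qed

lemma potential_cong:
  assumes "\<And>e. e \<in> M \<Longrightarrow> s e = s' e" "\<And>e. e \<in> F \<Longrightarrow> r e = r' e"
  shows "potential s r (M, F) = potential s' r' (M, F)"
proof -
  have L: "last_cands F r = last_cands F r'" using assms(2) by (auto simp: last_cands_def)
  then have U: "unmet M F r = unmet M F r'" by (simp add: unmet_def)
  have "last_cands F r' \<subseteq> F" "unmet M F r' \<subseteq> M" by (auto simp: last_cands_def unmet_def)
  then show ?thesis using assms L U unfolding potential_def
    by (auto intro!: arg_cong2[where f="(+)"] arg_cong2[where f="(-)"] sum.cong)
qed

text \<open>The first and third bounds change the potential by opposite amounts, so they cancel on
  average when the coin of \<open>e\<close> is still fair. The other two treat the second value of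
  an edge: it cannot be a reward, since the earlier sample would already have covered
  \<open>e\<close> in \<open>M\<close>; and as a sample it causes no loss.\<close>

lemma coin_step_potential:
  assumes sorted: "sorted_wrt (\<lambda>x y. v y < v x) (xs @ [(e, \<beta>)])"
    and sub: "fst ` set (xs @ [(e, \<beta>)]) \<subseteq> E" and fin: "finite E"
    and nn: "\<forall>e\<in>E. \<forall>\<beta>. 0 \<le> v (e, \<beta>)"
    and run: "coin_run C xs = (M, F)" and free: "\<forall>f\<in>M. \<not> meets f e"
  defines "s \<equiv> coin_sample E v C" and "r \<equiv> coin_reward E v C"
  defines "G \<equiv> (\<Sum>g\<in>{g\<in>last_cands F r. meets g e}. cover_factor M g * r g)"
  shows "\<beta> = (e \<notin> C) \<Longrightarrow> potential s r (coin_step C (e, \<beta>) (M, F)) \<ge> potential s r (M, F) + G - v (e, \<beta>) / 4"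
    and "\<beta> = (e \<notin> C) \<Longrightarrow> (e, \<not> \<beta>) \<in> set xs \<Longrightarrow>
      potential s r (coin_step C (e, \<beta>) (M, F)) \<ge> potential s r (M, F)"
    and "\<beta> \<noteq> (e \<notin> C) \<Longrightarrow> potential s r (coin_step C (e, \<beta>) (M, F)) \<ge> potential s r (M, F) - G + v (e, \<beta>) / 4"
    and "\<beta> \<noteq> (e \<notin> C) \<Longrightarrow> (e, \<not> \<beta>) \<notin> set xs"
proof -
  have s1: "sorted_wrt (\<lambda>x y. v y < v x) xs" "fst ` set xs \<subseteq> E"
    using sorted sub by (auto simp: sorted_wrt_append)
  note inv = coin_run_invariant[OF s1 run, folded s_def r_def]
  have less: "v (e, \<beta>) < v y" if "y \<in> set xs" for y
    using sorted that by (auto simp: sorted_wrt_append)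
  have e: "e \<in> E" using sub by auto
  have M: "(f, f \<notin> C) \<in> set xs" "f \<in> E" "s f = v (f, f \<notin> C)" if "f \<in> M" for f
  proof -
    show 1: "(f, f \<notin> C) \<in> set xs" using inv that by blast
    then show "f \<in> E" using s1(2) by force
    then show "s f = v (f, f \<notin> C)" by (simp add: s_def)
  qed
  have F: "(f, f \<in> C) \<in> set xs" "f \<in> E" "r f = v (f, f \<in> C)" "v (e, \<beta>) < r f" if "f \<in> F" for f
  proof -
    show 1: "(f, f \<in> C) \<in> set xs" using inv that by blast
    then show 2: "f \<in> E" using s1(2) by force
    then show 3: "r f = v (f, f \<in> C)" by (simp add: r_def)
    show "v (e, \<beta>) < r f" using less[OF 1] 3 by simp
  qed
  have finMF: "finite M" "finite F" using M(2) F(2) fin by (auto intro: finite_subset[of _ E])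
  have v0: "0 \<le> v (e, \<beta>)" using nn e by blast
  have r0: "\<forall>f\<in>F. 0 \<le> r f" using F(4) v0 by fastforce
  have s0: "\<forall>f\<in>M. 0 \<le> s f" using M(2,3) nn by simp
  have nofree: "\<not> (\<exists>f\<in>M. meets f e)" using free by blast
  have L: "finite (last_cands F r)" "last_cands F r \<subseteq> F" using finMF by (auto simp: last_cands_def)
  have Gt: "0 \<le> cover_factor M g * r g" if "g \<in> last_cands F r" for g
    using L(2) that r0 cover_factor_ge[of M g] by (intro mult_nonneg_nonneg) auto
  have G0: "0 \<le> G" unfolding G_def by (intro sum_nonneg) (use Gt in auto)
  {
    assume \<beta>: "\<beta> = (e \<notin> C)"
    then have step: "coin_step C (e, \<beta>) (M, F) = (insert e M, F)" using nofree by simp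
    have se: "s e = v (e, \<beta>)" using e \<beta> by (simp add: s_def)
    have P: "potential s r (insert e M, F) \<ge> potential s r (M, F) + G
      + (if e \<in> unmet (insert e M) F r then s e else 0) - s e / 4"
      unfolding G_def by (rule potential_sample[OF finMF free r0]) (use se v0 in simp)
    show "potential s r (coin_step C (e, \<beta>) (M, F)) \<ge> potential s r (M, F) + G - v (e, \<beta>) / 4"
      unfolding step using P se v0 by (auto split: if_splits)
    assume "(e, \<not> \<beta>) \<in> set xs"
    \<comment> \<open>The earlier value of \<open>e\<close> is its reward, and no edge of
      \<open>M\<close> sets a price on \<open>e\<close>.\<close>
    then have eF: "e \<in> F" using inv free \<beta> by auto
    show "potential s r (coin_step C (e, \<beta>) (M, F)) \<ge> potential s r (M, F)"
    proof (cases "\<exists>g\<in>last_cands F r. meets g e")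
      case True
      then obtain g where g: "g \<in> last_cands F r" "meets g e" by blast
      \<comment> \<open>The edge \<open>g\<close> alone pays for the loss
        \<open>v (e, \<beta>) / 4\<close>: its reward was seen earlier, hence is larger, and its
        cover factor is at least 1/4.\<close>
      have "v (e, \<beta>) / 4 \<le> 1 / 4 * r g" using F(4)[of g] g L(2) by auto
      also have "\<dots> \<le> cover_factor M g * r g"
        by (rule mult_right_mono[OF cover_factor_ge]) (use g L(2) r0 in auto)
      also have "\<dots> \<le> G" unfolding G_def
        by (rule member_le_sum) (use g L Gt in auto)
      finally show ?thesis unfolding step using P se v0 by (auto split: if_splits)
    next
      case False
      \<comment> \<open>Without a last edge that meets \<open>e\<close>, the sample of
        \<open>e\<close> is counted in full among the unmet edges.\<close>
      then have "e \<in> unmet (insert e M) F r" using eF by (auto simp: unmet_def)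
      then show ?thesis unfolding step using P se v0 G0 by simp
    qed
  next
    assume \<beta>: "\<beta> \<noteq> (e \<notin> C)"
    then have step: "coin_step C (e, \<beta>) (M, F) = (M, insert e F)" using nofree by simp
    have re: "r e = v (e, \<beta>)" using e \<beta> by (simp add: r_def)
    have eF: "e \<notin> F" using F(4)[of e] re by auto
    show "potential s r (coin_step C (e, \<beta>) (M, F)) \<ge> potential s r (M, F) - G + v (e, \<beta>) / 4"
      unfolding step G_def re[symmetric]
      by (rule potential_reward[OF finMF free eF]) (simp add: re F(4), rule s0)
    show "(e, \<not> \<beta>) \<notin> set xs"
    proof
      assume "(e, \<not> \<beta>) \<in> set xs"
      then have "(e, e \<notin> C) \<in> set xs" using \<beta> by auto
      then show False using inv free by blast
    qed
  }
qed

text \<open>The sum over all coin sets starts at 0 and does not decrease when a value is processed.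
  For the second value of an edge this holds for each coin set separately, for the first value after
  pairing the two outcomes of its coin.\<close>

lemma sum_potential_nonneg:
  assumes "sorted_wrt (\<lambda>x y. v y < v x) xs" "fst ` set xs \<subseteq> E" "finite E"
    and nn: "\<forall>e\<in>E. \<forall>\<beta>. 0 \<le> v (e, \<beta>)"
  shows "0 \<le> (\<Sum>C\<in>Pow E. potential (coin_sample E v C) (coin_reward E v C) (coin_run C xs))"
  using assms(1,2)
proof (induction xs rule: rev_induct)
  case Nil
  then show ?case by (simp add: potential_def last_cands_def unmet_def)
next
  case (snoc x xs)
  obtain e \<beta> where x: "x = (e, \<beta>)" by (cases x)
  let ?\<Phi> = "\<lambda>C. potential (coin_sample E v C) (coin_reward E v C)"
  have e: "e \<in> E" using snoc.prems(2) x by auto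
  note prems = snoc.prems[unfolded x]
  have s1: "sorted_wrt (\<lambda>x y. v y < v x) xs" "fst ` set xs \<subseteq> E"
    using snoc.prems by (auto simp: sorted_wrt_append)
  have new: "(e, \<beta>) \<notin> set xs" using prems(1) by (auto simp: sorted_wrt_append)
  note step = coin_step_potential[OF prems assms(3) nn]
  have "0 \<le> (\<Sum>C\<in>Pow E. ?\<Phi> C (coin_run C xs))" using snoc s1 by blast
  also have "\<dots> \<le> (\<Sum>C\<in>Pow E. ?\<Phi> C (coin_step C x (coin_run C xs)))"
  proof (cases "(e, \<not> \<beta>) \<in> set xs")
    case True
    show ?thesis
    proof (rule sum_mono)
      fix C
      obtain M F where run: "coin_run C xs = (M, F)" by (cases "coin_run C xs")
      show "?\<Phi> C (coin_run C xs) \<le> ?\<Phi> C (coin_step C x (coin_run C xs))"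
      proof (cases "\<exists>f\<in>M. meets f e")
        case False
        then have free: "\<forall>f\<in>M. \<not> meets f e" by blast
        show ?thesis
          using step(2)[OF run free _ True] step(4)[OF run free] True unfolding run x by blast
      qed (simp add: run x)
    qed
  next
    case False
    show ?thesis unfolding sum_Pow_remove[OF assms(3) e]
    proof (rule sum_mono)
      fix C assume C: "C \<in> Pow (E - {e})"
      let ?D = "insert e C"
      obtain M F where run: "coin_run C xs = (M, F)" by (cases "coin_run C xs")
      have "e \<notin> fst ` set xs"
      proof
        assume "e \<in> fst ` set xs"
        then obtain \<gamma> where "(e, \<gamma>) \<in> set xs" by force
        then show False using False new by (cases "\<gamma> = \<beta>") auto
      qed
      \<comment> \<open>The coin of the fresh edge has not been consulted, so both outcomes share
        the same past.\<close>
      then have run': "coin_run ?D xs = (M, F)"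
        using coin_run_cong[of C xs ?D] run by auto
      have MF: "M \<subseteq> fst ` set xs" "F \<subseteq> fst ` set xs"
        using coin_run_invariant[OF s1 run] by force+
      let ?s = "coin_sample E v" and ?r = "coin_reward E v"
      have eq: "?s C f = ?s ?D f" "?r C f = ?r ?D f" if "f \<in> fst ` set xs" for f
      proof -
        have "f \<in> E" "f \<noteq> e" using that s1(2) \<open>e \<notin> fst ` set xs\<close> by auto
        then show "?s C f = ?s ?D f" "?r C f = ?r ?D f" by auto
      qed
      have pot: "?\<Phi> C (M, F) = ?\<Phi> ?D (M, F)"
        by (rule potential_cong) (use eq MF in blast)+
      have L: "last_cands F (?r C) = last_cands F (?r ?D)"
        using eq(2) MF(2) unfolding last_cands_def by (auto simp: subset_iff)
      have G: "(\<Sum>g\<in>{g\<in>last_cands F (?r C). meets g e}. cover_factor M g * ?r C g)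
        = (\<Sum>g\<in>{g\<in>last_cands F (?r ?D). meets g e}. cover_factor M g * ?r ?D g)"
        unfolding L using eq(2) MF(2) by (intro sum.cong refl) (auto simp: last_cands_def subset_iff)
      show "?\<Phi> C (coin_run C xs) + ?\<Phi> ?D (coin_run ?D xs)
        \<le> ?\<Phi> C (coin_step C x (coin_run C xs)) + ?\<Phi> ?D (coin_step ?D x (coin_run ?D xs))"
      proof (cases "\<exists>f\<in>M. meets f e")
        case True
        then show ?thesis unfolding run run' x by simp
      next
        case free: False
        then have free: "\<forall>f\<in>M. \<not> meets f e" by blast
        have "e \<notin> C" "e \<in> ?D" using C by auto
        \<comment> \<open>The value is a sample for one of \<open>C\<close> and \<open>?D\<close>
          and a reward for the other. The two changes of the potential are bounded by opposite
          amounts, because the past and the sum over the last edges meeting \<open>e\<close>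
          agree.\<close>
        note r = step(1,3)[OF run free] step(1,3)[OF run' free]
        show ?thesis
        proof (cases \<beta>)
          case True
          then show ?thesis
            using r(1) r(4) \<open>e \<notin> C\<close> \<open>e \<in> ?D\<close> pot G unfolding run run' x by linarith
        next
          case False
          then show ?thesis
            using r(2) r(3) \<open>e \<notin> C\<close> \<open>e \<in> ?D\<close> pot G unfolding run run' x by linarith
        qed
      qed
    qed
  qed
  finally show ?case by simp
qed

section \<open>The mechanism for fixed values\<close>

lemma best_edges_iff:
  "e \<in> best_edges E p r M b \<longleftrightarrow> e \<in> feasible E p r M b \<and>
     (\<forall>f\<in>feasible E p r M b. r f - edge_price p f \<le> r e - edge_price p e)"
  unfolding best_edges_def is_arg_max_def mem_Collect_eq not_less[symmetric] by blast

lemma best_edges_nonempty: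
  assumes "finite E" "feasible E p r M b \<noteq> {}"
  shows "best_edges E p r M b \<noteq> {}"
proof -
  let ?X = "feasible E p r M b" and ?h = "\<lambda>e. r e - edge_price p e"
  have fin: "finite ?X" using assms(1) by (simp add: feasible_def)
  then have "Max (?h ` ?X) \<in> ?h ` ?X" using assms(2) by (intro Max_in) auto
  then obtain e where e: "e \<in> ?X" "Max (?h ` ?X) = ?h e" by (rule imageE)
  have "?h f \<le> ?h e" if "f \<in> ?X" for f
    unfolding e(2)[symmetric] using fin that by (intro Max_ge) auto
  then have "e \<in> best_edges E p r M b"
    using e(1) unfolding best_edges_iff by blast
  then show ?thesis by blast
qed

lemma best_edgesD:
  assumes "e \<in> best_edges E p r M b"
  shows "e \<in> feasible E p r M b"
    and "f \<in> feasible E p r M b \<Longrightarrow> r f - edge_price p f \<le> r e - edge_price p e"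
  using assms unfolding best_edges_iff by blast+

lemma serve_buyer_cases:
  assumes "finite E" "\<And>M A. A \<noteq> {} \<Longrightarrow> sel M A \<in> A"
  obtains "feasible E p r M b = {}" "serve_buyer sel E p r b (M, c) = (M, c)"
  | e where "e \<in> best_edges E p r M b"
      "serve_buyer sel E p r b (M, c) = (insert e M, c(b := edge_price p e))"
proof (cases "feasible E p r M b = {}")
  case False
  then have "sel M (best_edges E p r M b) \<in> best_edges E p r M b"
    using best_edges_nonempty[OF assms(1)] assms(2) by blast
  with False that(2) show ?thesis by (simp add: serve_buyer_def Let_def)
qed (use that(1) in \<open>simp add: serve_buyer_def\<close>)

lemma serve_buyer_cong:
  assumes "\<And>e. e \<in> E \<Longrightarrow> fst e = b \<Longrightarrow> r e = r' e"
  shows "serve_buyer sel E p r b = serve_buyer sel E p r' b"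
proof -
  have F: "feasible E p r M b = feasible E p r' M b" for M
    using assms unfolding feasible_def by auto
  have eq: "r e = r' e" if "e \<in> feasible E p r' M b" for e M
    using assms that unfolding feasible_def by auto
  have "e \<in> best_edges E p r M b \<longleftrightarrow> e \<in> best_edges E p r' M b" for e M
    unfolding best_edges_iff F by (intro conj_cong ball_cong refl) (simp add: eq)
  then have best: "best_edges E p r M b = best_edges E p r' M b" for M
    by blast
  show ?thesis unfolding serve_buyer_def F best ..
qed

text \<open>The buyers in \<open>bs\<close> see their own values only. For truthfulness, this makes
  the state before the turn of a buyer independent of her report.\<close>

lemma fold_serve_buyer_cong:
  assumes "\<And>e. e \<in> E \<Longrightarrow> fst e \<in> set bs \<Longrightarrow> r e = r' e"
  shows "fold (serve_buyer sel E p r) bs = fold (serve_buyer sel E p r') bs"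
proof -
  have "serve_buyer sel E p r b = serve_buyer sel E p r' b" if "b \<in> set bs" for b
    using assms that by (intro serve_buyer_cong) auto
  then have "fold (serve_buyer sel E p r) bs x = fold (serve_buyer sel E p r') bs x" for x
    by (intro List.fold_cong refl)
  then show ?thesis by (rule ext)
qed

text \<open>Buyers other than \<open>b\<close> add edges at themselves and change only their own
  charge.\<close>

lemma fold_serve_buyer_frame:
  assumes "finite E" "\<And>M A. A \<noteq> {} \<Longrightarrow> sel M A \<in> A" "b \<notin> set bs"
  shows "utility v b (fold (serve_buyer sel E p r) bs (M, c)) = utility v b (M, c)"
  using assms(3)
proof (induction bs arbitrary: M c)
  case (Cons a bs)
  then have ab: "a \<noteq> b" "b \<notin> set bs" by auto
  show ?case
  proof (rule serve_buyer_cases[where p=p and r=r and M=M and b=a and c=c, OF assms(1,2)])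
    assume "serve_buyer sel E p r a (M, c) = (M, c)"
    then show ?thesis using Cons.IH ab by simp
  next
    fix e assume e: "e \<in> best_edges E p r M a"
      "serve_buyer sel E p r a (M, c) = (insert e M, c(a := edge_price p e))"
    have "fst e = a" using best_edgesD(1)[OF e(1)] by (simp add: feasible_def)
    then have "{f \<in> insert e M. fst f = b} = {f \<in> M. fst f = b}" using ab by auto
    then have "utility v b (insert e M, c(a := edge_price p e)) = utility v b (M, c)"
      using ab by (simp add: utility_def)
    then show ?thesis using Cons.IH[OF ab(2)] by (simp only: e(2) fold_Cons o_apply)
  qed
qed simp

text \<open>The output is a maximal matching among the edges whose reward reaches the price: such an
  edge at a served buyer is met by the edge she took, or else its item was gone at her turn.\<close>

lemma fold_serve_buyer_invariant:
  assumes "finite E" "\<And>M A. A \<noteq> {} \<Longrightarrow> sel M A \<in> A" "distinct bs"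
    and "fold (serve_buyer sel E p r) bs ({}, \<lambda>_. 0) = (N, c)"
  shows "N \<subseteq> {e\<in>E. edge_price p e \<le> r e} \<and> fst ` N \<subseteq> set bs \<and> matching N
    \<and> (\<forall>e\<in>E. fst e \<in> set bs \<longrightarrow> edge_price p e \<le> r e \<longrightarrow> (\<exists>n\<in>N. meets n e))
    \<and> (\<forall>b. b \<notin> set bs \<longrightarrow> c b = 0)"
  using assms(3,4)
proof (induction bs arbitrary: N c rule: rev_induct)
  case Nil
  then show ?case by (auto simp: matching_def)
next
  case (snoc b bs)
  obtain N0 c0 where run: "fold (serve_buyer sel E p r) bs ({}, \<lambda>_. 0) = (N0, c0)"
    by (cases "fold (serve_buyer sel E p r) bs ({}, \<lambda>_. 0)")
  have bs: "distinct bs" "b \<notin> set bs" using snoc.prems(1) by auto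
  note IH = snoc.IH[OF bs(1) run]
  have N: "(N, c) = serve_buyer sel E p r b (N0, c0)" using snoc.prems(2) run by simp
  show ?case
  proof (rule serve_buyer_cases[where p=p and r=r and M=N0 and b=b and c=c0, OF assms(1,2)])
    assume *: "feasible E p r N0 b = {}" "serve_buyer sel E p r b (N0, c0) = (N0, c0)"
    have "\<exists>n\<in>N0. meets n e" if "e \<in> E" "fst e = b" "edge_price p e \<le> r e" for e
    \<comment> \<open>The edge passes the price test, so it can be infeasible only because its item
      is taken.\<close>
    proof -
      have "snd e \<in> snd ` N0" using *(1) that unfolding feasible_def by blast
      then obtain n where "n \<in> N0" "snd e = snd n" by (rule imageE)
      then show ?thesis by (auto simp: meets_iff)
    qed
    then show ?thesis using IH N * by auto
  next
    fix e assume *: "e \<in> best_edges E p r N0 b"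
      "serve_buyer sel E p r b (N0, c0) = (insert e N0, c0(b := edge_price p e))"
    have e: "e \<in> E" "fst e = b" "edge_price p e \<le> r e" "snd e \<notin> snd ` N0"
      using best_edgesD(1)[OF *(1)] by (auto simp: feasible_def)
    have Nc: "N = insert e N0" "c = c0(b := edge_price p e)" using N * by auto
    have I: "N0 \<subseteq> {e\<in>E. edge_price p e \<le> r e}" "fst ` N0 \<subseteq> set bs" "matching N0"
      "\<And>f. f \<in> E \<Longrightarrow> fst f \<in> set bs \<Longrightarrow> edge_price p f \<le> r f \<Longrightarrow> \<exists>n\<in>N0. meets n f"
      "\<And>b. b \<notin> set bs \<Longrightarrow> c0 b = 0"
      using IH by blast+
    have free: "\<not> meets f e" if "f \<in> N0" for f
    proof -
      have "fst f \<in> set bs" using I(2) that by blast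
      moreover have "snd f \<in> snd ` N0" using that by (rule imageI)
      ultimately show ?thesis using e(2,4) bs(2) unfolding meets_iff by metis
    qed
    have "N \<subseteq> {e\<in>E. edge_price p e \<le> r e}" using I(1) e unfolding Nc by blast
    moreover have "fst ` N \<subseteq> set (bs @ [b])" using I(2) e(2) unfolding Nc by auto
    moreover have "matching N" unfolding Nc(1) matching_insert_iff[OF I(3)] using free by blast
    moreover have "\<exists>n\<in>N. meets n f" if "f \<in> E" "fst f \<in> set (bs @ [b])" "edge_price p f \<le> r f" for f
    proof (cases "fst f = b")
      case True
      then show ?thesis using e(2) unfolding Nc(1) by (auto simp: meets_iff)
    next
      case False
      then have "fst f \<in> set bs" using that(2) by simp
      then show ?thesis using I(4)[of f] that unfolding Nc(1) by blast
    qed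
    moreover have "c a = 0" if "a \<notin> set (bs @ [b])" for a
      using I(5)[of a] that unfolding Nc(2) by simp
    ultimately show ?thesis by blast
  qed
qed

lemma mechanism_subset:
  assumes "finite E" "\<And>M A. A \<noteq> {} \<Longrightarrow> sel M A \<in> A" "distinct bs"
  shows "fst (mechanism sel E bs s \<tau> r) \<subseteq> E"
proof -
  obtain N c where N: "mechanism sel E bs s \<tau> r = (N, c)"
    by (cases "mechanism sel E bs s \<tau> r")
  show ?thesis
    using fold_serve_buyer_invariant[OF assms N[unfolded mechanism_def]] N by auto
qed

section \<open>Truthfulness\<close>

text \<open>The report of \<open>b\<close> affects neither the state at her turn nor her utility
  afterwards. At her turn every report yields a free edge at a fixed price or nothing, and the true
  report yields the best of these options.\<close>

lemma mechanism_truthful: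
  fixes E :: "('b \<times> 'i) set"
  assumes "finite E" "\<And>M A. A \<noteq> {} \<Longrightarrow> sel M A \<in> A" "distinct arrivals" "set arrivals = B"
  shows "truthful B E (mechanism sel E arrivals s \<tau>)"
  unfolding truthful_def
proof (intro ballI allI impI)
  fix b and v v' :: "'b \<times> 'i \<Rightarrow> real"
  assume b: "b \<in> B" and eq: "\<forall>e\<in>E. fst e \<noteq> b \<longrightarrow> v' e = v e"
  obtain pre post where arr: "arrivals = pre @ b # post"
    using b assms(4) split_list by metis
  have notin: "b \<notin> set pre" "b \<notin> set post" "distinct pre" using assms(3) arr by auto
  let ?p = "vertex_price s \<tau>"
  obtain M c where run: "fold (serve_buyer sel E ?p v) pre ({}, \<lambda>_. 0) = (M, c)"
    by (cases "fold (serve_buyer sel E ?p v) pre ({}, \<lambda>_. 0)")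
  have run': "fold (serve_buyer sel E ?p v') pre ({}, \<lambda>_. 0) = (M, c)"
    unfolding run[symmetric] using eq notin by (subst fold_serve_buyer_cong[of E pre v' v]) auto
  note inv = fold_serve_buyer_invariant[OF assms(1,2) notin(3) run]
  have Mb: "{e\<in>M. fst e = b} = {}" and cb: "c b = 0" using inv notin(1) by auto
  have U: "utility v b (mechanism sel E arrivals s \<tau> w) = utility v b (serve_buyer sel E ?p w b (M, c))"
    if "fold (serve_buyer sel E ?p w) pre ({}, \<lambda>_. 0) = (M, c)" for w
    unfolding mechanism_def arr using that
    by (cases "serve_buyer sel E ?p w b (M, c)")
      (simp add: fold_serve_buyer_frame[OF assms(1,2) notin(2)])
  have take: "utility v b (insert e M, c(b := edge_price ?p e)) = v e - edge_price ?p e"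
    if "e \<in> best_edges E ?p w M b" for e w
  proof -
    have "fst e = b" using best_edgesD(1)[OF that] by (simp add: feasible_def)
    then have "{f \<in> insert e M. fst f = b} = {e}" using Mb by auto
    then show ?thesis by (simp add: utility_def)
  qed
  have stay: "utility v b (M, c) = 0" by (simp only: utility_def prod.case Mb cb) simp
  let ?true = "utility v b (serve_buyer sel E ?p v b (M, c))"
  have lower: "0 \<le> ?true" "\<And>e. e \<in> feasible E ?p v M b \<Longrightarrow> v e - edge_price ?p e \<le> ?true"
  proof -
    consider "feasible E ?p v M b = {}" "serve_buyer sel E ?p v b (M, c) = (M, c)"
      | e where "e \<in> best_edges E ?p v M b"
          "serve_buyer sel E ?p v b (M, c) = (insert e M, c(b := edge_price ?p e))"
      by (rule serve_buyer_cases[OF assms(1,2)])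
    then have "0 \<le> ?true \<and> (\<forall>e\<in>feasible E ?p v M b. v e - edge_price ?p e \<le> ?true)"
    proof cases
      case 1
      then show ?thesis using stay by simp
    next
      case (2 e)
      have "edge_price ?p e \<le> v e" using best_edgesD(1)[OF 2(1)] by (simp add: feasible_def)
      then show ?thesis using 2 take[OF 2(1)] best_edgesD(2)[OF 2(1)] by auto
    qed
    then show "0 \<le> ?true" "\<And>e. e \<in> feasible E ?p v M b \<Longrightarrow> v e - edge_price ?p e \<le> ?true"
      by blast+
  qed
  have "utility v b (serve_buyer sel E ?p v' b (M, c)) \<le> ?true"
  proof (rule serve_buyer_cases[where p="?p" and r="v'" and M=M and b=b and c=c, OF assms(1,2)])
    assume "serve_buyer sel E ?p v' b (M, c) = (M, c)"
    then show ?thesis using lower(1) stay by simp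
  next
    fix e assume e: "e \<in> best_edges E ?p v' M b"
      "serve_buyer sel E ?p v' b (M, c) = (insert e M, c(b := edge_price ?p e))"
    have "v e - edge_price ?p e \<le> ?true"
    \<comment> \<open>An edge obtained by a false report is either feasible under the true values,
      hence no better than the one chosen there, or it costs more than it is worth.\<close>
    proof (cases "edge_price ?p e \<le> v e")
      case True
      then have "e \<in> feasible E ?p v M b"
        using best_edgesD(1)[OF e(1)] by (simp add: feasible_def)
      then show ?thesis by (rule lower(2))
    qed (use lower(1) in linarith)
    then show ?thesis using take[OF e(1)] e(2) by simp
  qed
  then show "utility v b (mechanism sel E arrivals s \<tau> v') \<le> utility v b (mechanism sel E arrivals s \<tau> v)"
    unfolding U[OF run] U[OF run'] .
qed

section \<open>Prices and the competitive bound for fixed values\<close>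

lemma vertex_price_covered:
  assumes "matching (sample_matching s \<tau>)" "f \<in> sample_matching s \<tau>" "k \<in> ends f"
  shows "vertex_price s \<tau> k = s f"
proof -
  have "(THE e. e \<in> sample_matching s \<tau> \<and> k \<in> ends e) = f"
  proof (rule the_equality)
    fix e assume "e \<in> sample_matching s \<tau> \<and> k \<in> ends e"
    then show "e = f" using assms unfolding matching_def by blast
  qed (use assms in auto)
  then show ?thesis using assms unfolding vertex_price_def by auto
qed

text \<open>An unmatched endpoint has the default price 0, which a nonnegative \<open>x\<close>
  always reaches; only the sample edges that meet \<open>e\<close> impose a condition.\<close>

lemma edge_price_le_iff:
  assumes "matching (sample_matching s \<tau>)" "0 \<le> x"
  shows "edge_price (vertex_price s \<tau>) e \<le> x \<longleftrightarrow>
     (\<forall>f\<in>sample_matching s \<tau>. meets f e \<longrightarrow> s f \<le> x)"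
proof -
  let ?M = "sample_matching s \<tau>"
  have vp: "vertex_price s \<tau> k \<le> x \<longleftrightarrow> (\<forall>f\<in>?M. k \<in> ends f \<longrightarrow> s f \<le> x)" for k
  proof (cases "\<exists>f\<in>?M. k \<in> ends f")
    case True
    then obtain f where f: "f \<in> ?M" "k \<in> ends f" by blast
    have uniq: "g = f" if "g \<in> ?M" "k \<in> ends g" for g
      using assms(1) f that unfolding matching_def by blast
    show ?thesis
    proof
      assume "vertex_price s \<tau> k \<le> x"
      then show "\<forall>f\<in>?M. k \<in> ends f \<longrightarrow> s f \<le> x"
        using uniq vertex_price_covered[OF assms(1) f] by metis
    next
      assume "\<forall>f\<in>?M. k \<in> ends f \<longrightarrow> s f \<le> x"
      then show "vertex_price s \<tau> k \<le> x"
        using f vertex_price_covered[OF assms(1) f] by metis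
    qed
  next
    case False
    then show ?thesis using assms(2) by (auto simp: vertex_price_def)
  qed
  obtain b i where e: "e = (b, i)" by (cases e)
  show ?thesis unfolding e edge_price.simps max.bounded_iff vp meets_def by auto
qed

text \<open>Greedy is a 2-approximation: each edge of a competing matching is charged to the edge
  that blocks it.\<close>

lemma opt_le_stable_matching:
  assumes "finite E" "stable_matching E s M" "\<And>e. e \<in> E \<Longrightarrow> 0 \<le> s e"
  shows "opt E s \<le> 2 * sum s M"
  unfolding opt_def
proof (rule Max.boundedI)
  show "finite (weight s ` {M. M \<subseteq> E \<and> matching M})" using assms(1) by simp
  show "weight s ` {M. M \<subseteq> E \<and> matching M} \<noteq> {}" by (auto simp: matching_def)
  fix x assume "x \<in> weight s ` {M. M \<subseteq> E \<and> matching M}"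
  then obtain A where A: "A \<subseteq> E" "matching A" "x = sum s A" by (auto simp: weight_def)
  have M: "M \<subseteq> E" "\<forall>e\<in>E. \<exists>f\<in>M. meets f e \<and> s e \<le> s f"
    using assms(2) by (auto simp: stable_matching_def)
  show "x \<le> 2 * sum s M" unfolding A(3)
  proof (rule matching_charge)
    fix e assume "e \<in> A"
    then obtain f where "f \<in> M" "meets f e" "s e \<le> s f" using M(2) A(1) by blast
    then show "\<exists>n\<in>M. meets e n \<and> s e \<le> s n" using meets_sym[of f e] by blast
  next
    show "finite A" "finite M" using A(1) M(1) assms(1) finite_subset by auto
    show "0 \<le> s n" if "n \<in> M" for n using M(1) assms(3) that by blast
  qed (rule A(2))
qed

text \<open>Two last edges that meet have equal rewards and so coincide, unmet edges belong to the
  matching \<open>M\<close>, and no last edge meets an unmet one; together they form a matching.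
  Maximality of \<open>N\<close> provides the edges to charge: lastness bounds the reward of a last
  edge, the price bounds the sample of an unmet edge.\<close>

lemma maximal_matching_weight:
  fixes s r :: "'b \<times> 'i \<Rightarrow> real"
  assumes "finite F" "inj_on r F" "matching M" "\<forall>e\<in>F. 0 \<le> r e"
    and price: "\<forall>e\<in>F. \<forall>f\<in>M. meets f e \<longrightarrow> s f < r e"
    and N: "N \<subseteq> F" "\<forall>e\<in>F. \<exists>n\<in>N. meets n e"
  shows "sum r (last_cands F r) + sum s (unmet M F r) \<le> 2 * sum r N"
proof -
  let ?L = "last_cands F r" and ?U = "unmet M F r"
  have sub: "?L \<subseteq> F" "?U \<subseteq> M" "?U \<subseteq> F" by (auto simp: last_cands_def unmet_def)
  have fin: "finite ?L" "finite ?U" using sub assms(1) finite_subset by blast+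
  have disj: "\<not> meets g f" if "g \<in> ?L" "f \<in> ?U" for f g
    using that by (simp add: unmet_def)
  then have LU: "?L \<inter> ?U = {}" by fastforce
  have mL: "e = f" if "e \<in> ?L" "f \<in> ?L" "meets e f" for e f
  proof -
    have "r e = r f" using that meets_sym[of e f] unfolding last_cands_def by force
    then show ?thesis using that sub(1) assms(2) by (auto dest: inj_onD)
  qed
  have mU: "e = f" if "e \<in> ?U" "f \<in> ?U" "meets e f" for e f
    using that sub(2) matching_meetsD[OF assms(3)] by blast
  have "matching (?L \<union> ?U)"
    unfolding matching_iff_meets using mL mU disj meets_sym by (metis Un_iff)
  \<comment> \<open>Last edges count with their reward, unmet edges with their sample.\<close>
  define y where "y e = (if e \<in> ?L then r e else s e)" for e
  have "sum r ?L + sum s ?U = sum y ?L + sum y ?U"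
    using LU unfolding y_def by (intro arg_cong2[where f="(+)"] sum.cong) auto
  also have "\<dots> = sum y (?L \<union> ?U)" using fin LU by (simp add: sum.union_disjoint)
  also have "\<dots> \<le> 2 * sum r N"
  proof (rule matching_charge)
    fix e assume e: "e \<in> ?L \<union> ?U"
    then obtain n where n: "n \<in> N" "meets n e" using N sub by blast
    have "y e \<le> r n"
    proof (cases "e \<in> ?L")
      case True
      then show ?thesis using n N(1) unfolding y_def last_cands_def by auto
    next
      case False
      then have "e \<in> M" using e sub by blast
      then have "s e < r n" using price n N(1) meets_sym[of n e] by blast
      then show ?thesis using False by (simp add: y_def)
    qed
    then show "\<exists>n\<in>N. meets e n \<and> y e \<le> r n" using n meets_sym[of n e] by blast
  next
    show "finite N" using N(1) assms(1) by (rule finite_subset)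
    show "0 \<le> r n" if "n \<in> N" for n using N(1) assms(4) that by blast
  qed (use fin \<open>matching (?L \<union> ?U)\<close> in auto)
  finally show ?thesis .
qed

lemma ex_decreasing_enumeration:
  fixes v :: "'a \<Rightarrow> real"
  assumes "finite A" "inj_on v A"
  obtains xs where "set xs = A" "sorted_wrt (\<lambda>x y. v y < v x) xs"
proof -
  obtain zs where zs: "set zs = A" "distinct zs" using finite_distinct_list[OF assms(1)] by blast
  define xs where "xs = sort_key (\<lambda>x. - v x) zs"
  have xs: "set xs = A" "distinct xs" using zs by (simp_all add: xs_def)
  have "sorted (map (\<lambda>x. - v x) xs)" by (simp add: xs_def)
  moreover have "distinct (map (\<lambda>x. - v x) xs)"
    using xs assms(2) by (auto simp: distinct_map inj_on_def)
  ultimately have "sorted_wrt (<) (map (\<lambda>x. - v x) xs)" by (simp add: strict_sorted_iff)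
  then have "sorted_wrt (\<lambda>x y. v y < v x) xs" by (simp add: sorted_wrt_map)
  with xs(1) show thesis by (rule that)
qed

text \<open>Twice the output weight is at least the weight of the last and unmet edges, which is at
  least the potential plus a quarter of the sample matching. Multiplying by 8 leaves twice the
  sample matching, which bounds the optimum for the samples.\<close>

lemma coin_mechanism_bound:
  fixes E :: "('b \<times> 'i) set" and C :: "('b \<times> 'i) set"
  assumes fin: "finite E" and nn: "\<forall>e\<in>E. \<forall>\<beta>. 0 \<le> v (e, \<beta>)" and inj: "inj_on v (E \<times> UNIV)"
    and sel: "\<forall>M A. A \<noteq> {} \<longrightarrow> sel M A \<in> A" and arr: "distinct arrivals" "fst ` E \<subseteq> set arrivals"
    and \<tau>: "set \<tau> = E"
    and xs: "set xs = E \<times> UNIV" "sorted_wrt (\<lambda>x y. v y < v x) xs"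
  defines "s \<equiv> coin_sample E v C" and "r \<equiv> coin_reward E v C"
  shows "8 * potential s r (coin_run C xs) + opt E s \<le> 16 * weight r (fst (mechanism sel E arrivals s \<tau> r))"
proof -
  obtain M F where run: "coin_run C xs = (M, F)" by (cases "coin_run C xs")
  have sub: "fst ` set xs \<subseteq> E" using xs(1) by auto
  note inv = coin_run_invariant[OF xs(2) sub run, folded s_def r_def]
  have mem: "(e, \<beta>) \<in> set xs \<longleftrightarrow> e \<in> E" for e \<beta> using xs(1) by simp
  have s: "s e = v (e, e \<notin> C)" if "e \<in> E" for e using that by (simp add: s_def)
  have r: "r e = v (e, e \<in> C)" if "e \<in> E" for e using that by (simp add: r_def)
  have s0: "0 \<le> s e" and r0: "0 \<le> r e" if "e \<in> E" for e
    using nn that by (simp_all add: s r)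
  have stable: "stable_matching E s M" using inv mem unfolding stable_matching_def by blast
  have "inj_on s E"
  proof (rule inj_onI)
    fix e f assume "e \<in> E" "f \<in> E" "s e = s f"
    then have "(e, e \<notin> C) = (f, f \<notin> C)" by (intro inj_onD[OF inj]) (simp_all add: s)
    then show "e = f" by simp
  qed
  \<comment> \<open>With distinct samples the stable matching is unique, so the enumeration
    \<open>\<tau>\<close> does not influence it.\<close>
  then have M: "sample_matching s \<tau> = M"
    using stable_matching_unique[OF fin _ sample_matching_stable[OF \<tau>] stable] by blast
  have ME: "M \<subseteq> E" and mM: "matching M" using stable by (auto simp: stable_matching_def)
  have F: "F = {e\<in>E. \<forall>f\<in>M. meets f e \<longrightarrow> s f < r e}" using inv mem by blast
  \<comment> \<open>No reward ties with a price sample, so the weak acceptance test of the mechanism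
    agrees with the strict one that defines \<open>F\<close>.\<close>
  have neq: "s f \<noteq> r e" if "f \<in> E" "e \<in> E" for e f
  proof
    assume "s f = r e"
    then have "(f, f \<notin> C) = (e, e \<in> C)" using that by (intro inj_onD[OF inj]) (simp_all add: s r)
    then show False by auto
  qed
  let ?p = "vertex_price s \<tau>"
  have price: "edge_price ?p e \<le> r e \<longleftrightarrow> (\<forall>f\<in>M. meets f e \<longrightarrow> s f < r e)" if "e \<in> E" for e
  proof -
    have "edge_price ?p e \<le> r e \<longleftrightarrow> (\<forall>f\<in>M. meets f e \<longrightarrow> s f \<le> r e)"
      using edge_price_le_iff[of s \<tau> "r e" e] mM M r0[OF that] by simp
    moreover have "s f \<le> r e \<longleftrightarrow> s f < r e" if "f \<in> M" for f
      using neq[of f e] that ME \<open>e \<in> E\<close> by auto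
    ultimately show ?thesis by simp
  qed
  obtain N c where N: "mechanism sel E arrivals s \<tau> r = (N, c)"
    by (cases "mechanism sel E arrivals s \<tau> r")
  have sel': "sel M A \<in> A" if "A \<noteq> {}" for M A using sel that by blast
  note invN = fold_serve_buyer_invariant[OF fin sel' arr(1) N[unfolded mechanism_def]]
  have NF: "N \<subseteq> F"
  proof
    fix n assume "n \<in> N"
    then have "n \<in> E" "edge_price ?p n \<le> r n" using invN by blast+
    then show "n \<in> F" using price[of n] unfolding F by simp
  qed
  have cov: "\<forall>e\<in>F. \<exists>n\<in>N. meets n e"
  proof
    fix e assume "e \<in> F"
    then have e: "e \<in> E" "edge_price ?p e \<le> r e" using price[of e] unfolding F by auto
    moreover have "fst e \<in> set arrivals" using e(1) arr(2) by blast
    ultimately show "\<exists>n\<in>N. meets n e" using invN by blast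
  qed
  have FE: "F \<subseteq> E" unfolding F by blast
  have finF: "finite F" using FE fin by (rule finite_subset)
  have injr: "inj_on r F"
  proof (rule inj_onI)
    fix e f assume ef: "e \<in> F" "f \<in> F" "r e = r f"
    then have "e \<in> E" "f \<in> E" using FE by blast+
    then have "(e, e \<in> C) = (f, f \<in> C)"
      using ef(3) by (intro inj_onD[OF inj]) (simp_all add: r)
    then show "e = f" by simp
  qed
  have "sum r (last_cands F r) + sum s (unmet M F r) \<le> 2 * sum r N"
  proof (rule maximal_matching_weight[OF finF injr mM _ _ NF cov])
    show "\<forall>e\<in>F. 0 \<le> r e" using FE r0 by blast
    show "\<forall>e\<in>F. \<forall>f\<in>M. meets f e \<longrightarrow> s f < r e" unfolding F by blast
  qed
  moreover have "potential s r (M, F) \<le> sum r (last_cands F r) + sum s (unmet M F r) - sum s M / 4"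
  proof -
    have "cover_factor M g * r g \<le> r g" if "g \<in> last_cands F r" for g
    proof -
      have "g \<in> E" using that FE by (auto simp: last_cands_def)
      then have "0 \<le> r g" by (rule r0)
      then show ?thesis using mult_right_mono[OF cover_factor_le[of M g]] by fastforce
    qed
    then have "(\<Sum>g\<in>last_cands F r. cover_factor M g * r g) \<le> sum r (last_cands F r)"
      by (rule sum_mono)
    then show ?thesis by (simp add: potential_def)
  qed
  moreover have "opt E s \<le> 2 * sum s M"
    by (rule opt_le_stable_matching[OF fin stable s0])
  ultimately show ?thesis unfolding run N weight_def fst_conv by linarith
qed

lemma opt_cong: "(\<And>e. e \<in> E \<Longrightarrow> r e = r' e) \<Longrightarrow> opt E r = opt E r'"
proof -
  assume "\<And>e. e \<in> E \<Longrightarrow> r e = r' e"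
  then have "weight r M = weight r' M" if "M \<subseteq> E" for M
    using that unfolding weight_def by (intro sum.cong) auto
  then have "weight r ` {M. M \<subseteq> E \<and> matching M} = weight r' ` {M. M \<subseteq> E \<and> matching M}"
    by (intro image_cong) auto
  then show ?thesis by (simp add: opt_def)
qed

text \<open>Sums the bound for a single coin set over all coin sets; the potential then drops out,
  as its sum is nonnegative.\<close>

lemma coin_average:
  fixes E :: "('b \<times> 'i) set"
  assumes fin: "finite E" and nn: "\<forall>e\<in>E. \<forall>\<beta>. 0 \<le> v (e, \<beta>)" and inj: "inj_on v (E \<times> UNIV)"
    and sel: "\<forall>M A. A \<noteq> {} \<longrightarrow> sel M A \<in> A" and arr: "distinct arrivals" "fst ` E \<subseteq> set arrivals"
    and \<tau>: "set \<tau> = E"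
  shows "(\<Sum>C\<in>Pow E. opt E (coin_reward E v C)) \<le> 16 * (\<Sum>C\<in>Pow E.
     weight (coin_reward E v C) (fst (mechanism sel E arrivals (coin_sample E v C) \<tau> (coin_reward E v C))))"
proof -
  let ?W = "\<lambda>C. weight (coin_reward E v C)
    (fst (mechanism sel E arrivals (coin_sample E v C) \<tau> (coin_reward E v C)))"
  have "finite (E \<times> (UNIV :: bool set))" using fin by simp
  then obtain xs where xs: "set xs = E \<times> UNIV" "sorted_wrt (\<lambda>x y. v y < v x) xs"
    using ex_decreasing_enumeration inj by metis
  let ?\<Phi> = "\<lambda>C. potential (coin_sample E v C) (coin_reward E v C) (coin_run C xs)"
  \<comment> \<open>Complementing the coin set exchanges samples and rewards.\<close>
  have "(\<Sum>C\<in>Pow E. opt E (coin_reward E v C)) = (\<Sum>C\<in>Pow E. opt E (coin_sample E v C))"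
  proof (rule sum.reindex_bij_witness[of _ "\<lambda>C. E - C" "\<lambda>C. E - C"])
    fix C assume "C \<in> Pow E"
    then show "opt E (coin_sample E v (E - C)) = opt E (coin_reward E v C)"
      by (intro opt_cong) auto
  qed auto
  also have "\<dots> \<le> (\<Sum>C\<in>Pow E. 16 * ?W C - 8 * ?\<Phi> C)"
  proof (rule sum_mono)
    fix C
    show "opt E (coin_sample E v C) \<le> 16 * ?W C - 8 * ?\<Phi> C"
      using coin_mechanism_bound[OF fin nn inj sel arr \<tau> xs, of C] by linarith
  qed
  also have "\<dots> = 16 * (\<Sum>C\<in>Pow E. ?W C) - 8 * (\<Sum>C\<in>Pow E. ?\<Phi> C)"
    by (simp only: sum_subtractf sum_distrib_left)
  also have "\<dots> \<le> 16 * (\<Sum>C\<in>Pow E. ?W C)"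
    using sum_potential_nonneg[OF xs(2) _ fin nn] xs(1) by simp
  finally show ?thesis .
qed

section \<open>Measurability and the coin coupling\<close>

text \<open>Matchings and edge orders are treated as simple functions, so measurability follows by
  splitting into the finitely many cases of \<open>g\<close>.\<close>

lemma measurable_simple_bind:
  assumes g: "simple_function M g"
    and h: "\<And>x. x \<in> g ` space M \<Longrightarrow> h x \<in> measurable M N"
  shows "(\<lambda>\<omega>. h (g \<omega>) \<omega>) \<in> measurable M N"
proof (rule measurableI)
  fix \<omega> assume \<omega>: "\<omega> \<in> space M"
  then have "h (g \<omega>) \<in> measurable M N" by (intro h imageI)
  then show "h (g \<omega>) \<omega> \<in> space N" using \<omega> by (rule measurable_space)
next
  fix A assume A: "A \<in> sets N"
  have "(\<lambda>\<omega>. h (g \<omega>) \<omega>) -` A \<inter> space M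
      = (\<Union>x\<in>g ` space M. (g -` {x} \<inter> space M) \<inter> (h x -` A \<inter> space M))" by auto
  also have "\<dots> \<in> sets M"
  proof (rule sets.finite_UN)
    show "finite (g ` space M)" by (rule simple_functionD(1)[OF g])
    show "(g -` {x} \<inter> space M) \<inter> (h x -` A \<inter> space M) \<in> sets M" if "x \<in> g ` space M" for x
      by (rule sets.Int[OF simple_functionD(2)[OF g] measurable_sets[OF h[OF that] A]])
  qed
  finally show "(\<lambda>\<omega>. h (g \<omega>) \<omega>) -` A \<inter> space M \<in> sets M" .
qed

lemma simple_function_bind:
  assumes g: "simple_function M g"
    and h: "\<And>x. x \<in> g ` space M \<Longrightarrow> simple_function M (h x)"
  shows "simple_function M (\<lambda>\<omega>. h (g \<omega>) \<omega>)"
  unfolding simple_function_def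
proof (intro conjI ballI)
  have "(\<lambda>\<omega>. h (g \<omega>) \<omega>) ` space M \<subseteq> (\<Union>x\<in>g ` space M. h x ` space M)" by auto
  moreover have "finite (\<Union>x\<in>g ` space M. h x ` space M)"
    using simple_functionD(1)[OF g] simple_functionD(1)[OF h] by blast
  ultimately show "finite ((\<lambda>\<omega>. h (g \<omega>) \<omega>) ` space M)" by (rule finite_subset)
next
  fix y
  have "(\<lambda>\<omega>. h (g \<omega>) \<omega>) -` {y} \<inter> space M
      = (\<Union>x\<in>g ` space M. (g -` {x} \<inter> space M) \<inter> (h x -` {y} \<inter> space M))" by auto
  also have "\<dots> \<in> sets M"
  proof (rule sets.finite_UN)
    show "finite (g ` space M)" by (rule simple_functionD(1)[OF g])
    show "(g -` {x} \<inter> space M) \<inter> (h x -` {y} \<inter> space M) \<in> sets M" if "x \<in> g ` space M" for x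
      by (rule sets.Int[OF simple_functionD(2)[OF g] simple_functionD(2)[OF h[OF that]]])
  qed
  finally show "(\<lambda>\<omega>. h (g \<omega>) \<omega>) -` {y} \<inter> space M \<in> sets M" .
qed

lemma simple_function_Collect:
  assumes "finite A" and P: "\<And>e. e \<in> A \<Longrightarrow> {\<omega>\<in>space M. P e \<omega>} \<in> sets M"
  shows "simple_function M (\<lambda>\<omega>. {e\<in>A. P e \<omega>})"
  unfolding simple_function_def
proof (intro conjI ballI)
  have "(\<lambda>\<omega>. {e\<in>A. P e \<omega>}) ` space M \<subseteq> Pow A" by auto
  then show "finite ((\<lambda>\<omega>. {e\<in>A. P e \<omega>}) ` space M)"
    using assms(1) finite_subset by blast
next
  fix X assume "X \<in> (\<lambda>\<omega>. {e\<in>A. P e \<omega>}) ` space M"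
  then have "X \<subseteq> A" by auto
  then have "(\<lambda>\<omega>. {e\<in>A. P e \<omega>}) -` {X} \<inter> space M = {\<omega>\<in>space M. \<forall>e\<in>A. P e \<omega> = (e \<in> X)}"
    by blast
  also have "\<dots> \<in> sets M"
  proof (rule sets.sets_Collect_finite_All[OF _ assms(1)])
    show "{\<omega> \<in> space M. P e \<omega> = (e \<in> X)} \<in> sets M" if "e \<in> A" for e
      using P[OF that] by (cases "e \<in> X") (auto intro: sets.sets_Collect_neg)
  qed
  finally show "(\<lambda>\<omega>. {e\<in>A. P e \<omega>}) -` {X} \<inter> space M \<in> sets M" .
qed

lemma simple_function_insort_key:
  fixes k :: "'a \<Rightarrow> 'w \<Rightarrow> real"
  assumes [measurable]: "\<And>e. k e \<in> borel_measurable M"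
  shows "simple_function M (\<lambda>\<omega>. insort_key (\<lambda>e. k e \<omega>) x xs)"
proof (induction xs)
  case (Cons y ys)
  have "simple_function M (\<lambda>\<omega>. if k x \<omega> \<le> k y \<omega> then x # y # ys
      else y # insort_key (\<lambda>e. k e \<omega>) x ys)"
    using Cons by (intro simple_function_If simple_function_compose1[where g="(#) y"]) auto
  then show ?case by simp
qed simp

lemma simple_function_sort_key:
  fixes k :: "'a \<Rightarrow> 'w \<Rightarrow> real"
  assumes "\<And>e. k e \<in> borel_measurable M"
  shows "simple_function M (\<lambda>\<omega>. sort_key (\<lambda>e. k e \<omega>) xs)"
proof (induction xs)
  case (Cons y ys)
  have "simple_function M (\<lambda>\<omega>. insort_key (\<lambda>e. k e \<omega>) y (sort_key (\<lambda>e. k e \<omega>) ys))"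
    by (rule simple_function_bind[OF Cons simple_function_insort_key[OF assms]])
  then show ?case by simp
qed simp

section \<open>Measurability of the mechanism for random samples, rewards and tie-breaking\<close>

context
  fixes \<Omega> :: "'w measure" and S R :: "'w \<Rightarrow> 'b \<times> 'i \<Rightarrow> real" and T :: "'w \<Rightarrow> ('b \<times> 'i) list"
  assumes S [measurable]: "\<And>e. (\<lambda>\<omega>. S \<omega> e) \<in> borel_measurable \<Omega>"
    and R [measurable]: "\<And>e. (\<lambda>\<omega>. R \<omega> e) \<in> borel_measurable \<Omega>"
    and T: "simple_function \<Omega> T"
begin

lemma simple_function_sample_matching: "simple_function \<Omega> (\<lambda>\<omega>. sample_matching (S \<omega>) (T \<omega>))"
proof -
  have "simple_function \<Omega> (\<lambda>\<omega>. sort_key (\<lambda>e. - S \<omega> e) \<tau>)" for \<tau>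
    by (rule simple_function_sort_key) measurable
  then have "simple_function \<Omega> (\<lambda>\<omega>. greedy (sort_key (\<lambda>e. - S \<omega> e) \<tau>))" for \<tau>
    by (rule simple_function_compose1)
  from simple_function_bind[OF T this] show ?thesis by (simp add: sample_matching_def)
qed

lemma measurable_vertex_price [measurable]: "(\<lambda>\<omega>. vertex_price (S \<omega>) (T \<omega>) k) \<in> borel_measurable \<Omega>"
  unfolding vertex_price_def
  by (rule measurable_simple_bind[OF simple_function_sample_matching,
        where h="\<lambda>N \<omega>. if \<exists>e\<in>N. k \<in> ends e then S \<omega> (THE e. e \<in> N \<and> k \<in> ends e) else 0"])
    measurable

lemma measurable_edge_price [measurable]:
  "(\<lambda>\<omega>. edge_price (vertex_price (S \<omega>) (T \<omega>)) e) \<in> borel_measurable \<Omega>"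
  by (cases e) simp

lemma simple_function_mechanism:
  assumes "finite E"
  shows "simple_function \<Omega> (\<lambda>\<omega>. fst (mechanism sel E bs (S \<omega>) (T \<omega>) (R \<omega>)))"
proof (induction bs rule: rev_induct)
  case Nil
  then show ?case by (simp add: mechanism_def)
next
  case (snoc b bs)
  let ?p = "\<lambda>\<omega>. vertex_price (S \<omega>) (T \<omega>)"
  let ?F = "\<lambda>N \<omega>. feasible E (?p \<omega>) (R \<omega>) N b"
  let ?B = "\<lambda>N \<omega>. best_edges E (?p \<omega>) (R \<omega>) N b"
  \<comment> \<open>The matching component of \<open>serve_buyer\<close>. It is a fixed function of
    three finitely valued arguments, so composing with the arbitrary rule \<open>sel\<close> keeps
    the result simple.\<close>
  define step where "step N X Y = (if X = {} then N else insert (sel N Y) N)"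
    for N X Y :: "('b \<times> 'i) set"
  have [measurable]: "{\<omega>\<in>space \<Omega>. e \<in> ?F N \<omega>} \<in> sets \<Omega>" for N e
    unfolding feasible_def mem_Collect_eq by measurable
  have F: "simple_function \<Omega> (?F N)" for N
    unfolding feasible_def by (rule simple_function_Collect[OF assms]) measurable
  have "?B N \<omega> = {e\<in>E. e \<in> ?F N \<omega> \<and> (\<forall>f\<in>E. f \<in> ?F N \<omega> \<longrightarrow>
     R \<omega> f - edge_price (?p \<omega>) f \<le> R \<omega> e - edge_price (?p \<omega>) e)}" for N \<omega>
    unfolding best_edges_def is_arg_max_def not_less[symmetric] feasible_def by blast
  moreover have "simple_function \<Omega> (\<lambda>\<omega>. {e\<in>E. e \<in> ?F N \<omega> \<and> (\<forall>f\<in>E. f \<in> ?F N \<omega> \<longrightarrow>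
     R \<omega> f - edge_price (?p \<omega>) f \<le> R \<omega> e - edge_price (?p \<omega>) e)})" for N
  proof (rule simple_function_Collect[OF assms])
    fix e
    have [measurable]: "Measurable.pred \<Omega> (\<lambda>\<omega>. f \<in> ?F N \<omega>)" for f
      unfolding pred_def by measurable
    show "{\<omega> \<in> space \<Omega>. e \<in> ?F N \<omega> \<and> (\<forall>f\<in>E. f \<in> ?F N \<omega> \<longrightarrow>
       R \<omega> f - edge_price (?p \<omega>) f \<le> R \<omega> e - edge_price (?p \<omega>) e)} \<in> sets \<Omega>"
      using assms by measurable
  qed
  ultimately have B: "simple_function \<Omega> (?B N)" for N by simp
  have "simple_function \<Omega> (\<lambda>\<omega>. step N (?F N \<omega>) (?B N \<omega>))" for N
    by (rule simple_function_compose2[OF F B])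
  from simple_function_bind[OF snoc this]
  have "simple_function \<Omega> (\<lambda>\<omega>. let N = fst (mechanism sel E bs (S \<omega>) (T \<omega>) (R \<omega>))
      in step N (?F N \<omega>) (?B N \<omega>))"
    by (simp add: Let_def)
  moreover have "fst (serve_buyer sel E p r b st) =
      step (fst st) (feasible E p r (fst st) b) (best_edges E p r (fst st) b)" for p r st
    by (cases st) (simp add: serve_buyer_def step_def Let_def)
  ultimately show ?case by (simp add: mechanism_def Let_def)
qed

lemma measurable_mechanism_weight:
  assumes "finite E"
  shows "(\<lambda>\<omega>. weight (R \<omega>) (fst (mechanism sel E bs (S \<omega>) (T \<omega>) (R \<omega>)))) \<in> borel_measurable \<Omega>"
  by (rule measurable_simple_bind[OF simple_function_mechanism[OF assms],
        where h="\<lambda>N \<omega>. weight (R \<omega>) N"]) (simp add: weight_def)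

lemma measurable_opt:
  assumes "finite E"
  shows "(\<lambda>\<omega>. opt E (R \<omega>)) \<in> borel_measurable \<Omega>"
proof -
  have "opt E (R \<omega>) = Max ((\<lambda>M. weight (R \<omega>) M) ` {M. M \<subseteq> E \<and> matching M})" for \<omega>
    by (simp add: opt_def)
  then show ?thesis
    using assms by (simp only:) (intro borel_measurable_Max, auto simp: weight_def matching_def)
qed

end

section \<open>Product measures and the exchange of samples and rewards\<close>

text \<open>Integrating coordinate \<open>x\<close> first, with the others fixed, leaves the single
  point \<open>w y\<close>, which is a null set of \<open>M x\<close>.\<close>

lemma AE_PiM_neq:
  fixes M :: "'a \<Rightarrow> real measure"
  assumes "finite K" "\<And>i. prob_space (M i)" "\<And>i. sets (M i) = sets borel"
    and atomless: "\<And>z. measure (M x) {z} = 0" and xy: "x \<in> K" "y \<in> K" "x \<noteq> y"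
  shows "AE w in PiM K M. w x \<noteq> w y"
proof -
  interpret product_sigma_finite M
    using assms(2) prob_space_imp_sigma_finite unfolding product_sigma_finite_def by blast
  interpret Mx: prob_space "M x" by (rule assms(2))
  let ?K = "K - {x}"
  have K: "insert x ?K = K" using xy by auto
  have comp: "(\<lambda>w. w i) \<in> borel_measurable (PiM K M)" if "i \<in> K" for i
    using measurable_component_singleton[OF that, of M] measurable_cong_sets[OF refl assms(3)] by blast
  let ?f = "indicator {w\<in>space (PiM K M). w x = w y} :: _ \<Rightarrow> ennreal"
  have A: "{w\<in>space (PiM K M). w x = w y} \<in> sets (PiM K M)"
    using comp[OF xy(1)] comp[OF xy(2)] by measurable
  then have f: "?f \<in> borel_measurable (PiM (insert x ?K) M)" unfolding K by simp
  have "emeasure (PiM K M) {w\<in>space (PiM K M). w x = w y} = integral\<^sup>N (PiM K M) ?f"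
    using A by simp
  also have "\<dots> = (\<integral>\<^sup>+ w. (\<integral>\<^sup>+ z. ?f (w(x := z)) \<partial>(M x)) \<partial>(PiM ?K M))"
    using product_nn_integral_insert[OF _ _ f] assms(1) unfolding K by simp
  also have "\<dots> \<le> (\<integral>\<^sup>+ w. 0 \<partial>(PiM ?K M))"
  proof (rule nn_integral_mono)
    fix w
    have "(\<integral>\<^sup>+ z. ?f (w(x := z)) \<partial>(M x)) \<le> (\<integral>\<^sup>+ z. indicator {w y} z \<partial>(M x))"
      using xy(3) by (intro nn_integral_mono) (auto split: split_indicator)
    also have "\<dots> = emeasure (M x) {w y}" using assms(3) by simp
    also have "\<dots> = 0" using atomless by (simp add: Mx.emeasure_eq_measure)
    finally show "(\<integral>\<^sup>+ z. ?f (w(x := z)) \<partial>(M x)) \<le> 0" .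
  qed
  finally have "emeasure (PiM K M) {w\<in>space (PiM K M). w x = w y} = 0" by simp
  then have "{w\<in>space (PiM K M). w x = w y} \<in> null_sets (PiM K M)" using A by blast
  then show ?thesis by (rule AE_I') auto
qed

lemma AE_PiM_inj_on:
  fixes M :: "'a \<Rightarrow> real measure"
  assumes "finite K" "\<And>i. prob_space (M i)" "\<And>i. sets (M i) = sets borel"
    and "\<And>x z. x \<in> K \<Longrightarrow> measure (M x) {z} = 0"
  shows "AE \<omega> in PiM K M. inj_on \<omega> K"
proof -
  have "AE \<omega> in PiM K M. \<forall>x\<in>K. \<forall>y\<in>K. x \<noteq> y \<longrightarrow> \<omega> x \<noteq> \<omega> y"
    using assms by (intro AE_finite_allI) (auto intro!: AE_PiM_neq AE_impI)
  then show ?thesis by eventually_elim (auto simp: inj_on_def)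
qed

text \<open>For each fixed \<open>C\<close>, deciding by \<open>C\<close> which of two independent
  draws is the sample reproduces the original law. The inverse map \<open>?merge\<close> is easier
  to handle, since it pulls boxes back to products of boxes.\<close>

lemma distr_PiM_coin:
  fixes D :: "'a \<Rightarrow> 'c measure"
  assumes fin: "finite E" and "\<And>e. prob_space (D e)"
  shows "distr (PiM (E \<times> UNIV) (\<lambda>x. D (fst x))) (PiM E D \<Otimes>\<^sub>M PiM E D)
      (\<lambda>\<omega>. (\<lambda>e\<in>E. \<omega> (e, e \<notin> C), \<lambda>e\<in>E. \<omega> (e, e \<in> C))) = PiM E D \<Otimes>\<^sub>M PiM E D"
proof -
  interpret D: product_sigma_finite D
    using assms(2) prob_space_imp_sigma_finite unfolding product_sigma_finite_def by blast
  interpret D2: product_sigma_finite "\<lambda>x :: 'a \<times> bool. D (fst x)"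
    using assms(2) prob_space_imp_sigma_finite unfolding product_sigma_finite_def by blast
  interpret P: prob_space "PiM E D" by (rule prob_space_PiM) (rule assms(2))
  let ?P = "PiM E D" and ?Q = "PiM (E \<times> (UNIV::bool set)) (\<lambda>x. D (fst x))"
  let ?split = "\<lambda>\<omega>. (\<lambda>e\<in>E. \<omega> (e, e \<notin> C), \<lambda>e\<in>E. \<omega> (e, e \<in> C))"
  let ?merge = "\<lambda>(s, r). \<lambda>x\<in>E \<times> (UNIV::bool set). if snd x = (fst x \<notin> C) then s (fst x) else r (fst x)"
  have merge [measurable]: "?merge \<in> measurable (?P \<Otimes>\<^sub>M ?P) ?Q"
    unfolding case_prod_beta
  proof (rule measurable_restrict)
    fix x :: "'a \<times> bool" assume "x \<in> E \<times> UNIV"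
    then have "fst x \<in> E" by auto
    then show "(\<lambda>p. if snd x = (fst x \<notin> C) then fst p (fst x) else snd p (fst x))
        \<in> measurable (?P \<Otimes>\<^sub>M ?P) (D (fst x))"
      by (cases "snd x = (fst x \<notin> C)") simp_all
  qed
  have comp [measurable]: "(\<lambda>\<omega>. \<omega> (e, \<beta>)) \<in> measurable ?Q (D e)" if "e \<in> E" for e \<beta>
    using measurable_component_singleton[of "(e, \<beta>)" "E \<times> UNIV" "\<lambda>x. D (fst x)"] that by simp
  have split [measurable]: "?split \<in> measurable ?Q (?P \<Otimes>\<^sub>M ?P)"
    by (intro measurable_Pair measurable_restrict comp)
  have "distr (?P \<Otimes>\<^sub>M ?P) ?Q ?merge = ?Q"
  proof (rule D2.PiM_eqI)
    fix A :: "'a \<times> bool \<Rightarrow> 'c set"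
    assume A: "\<And>x. x \<in> E \<times> UNIV \<Longrightarrow> A x \<in> sets (D (fst x))"
    let ?A1 = "\<lambda>e. A (e, e \<notin> C)" and ?A2 = "\<lambda>e. A (e, e \<in> C)"
    have A': "A (e, \<beta>) \<in> sets (D e)" if "e \<in> E" for e \<beta> using A[of "(e, \<beta>)"] that by simp
    have "?merge -` Pi\<^sub>E (E \<times> UNIV) A \<inter> space (?P \<Otimes>\<^sub>M ?P) = Pi\<^sub>E E ?A1 \<times> Pi\<^sub>E E ?A2"
      (is "?L = ?R")
    proof (rule set_eqI, rule iffI)
      fix p assume p: "p \<in> ?L"
      obtain s r where sr: "p = (s, r)" by (cases p)
      have sp: "s \<in> space ?P" "r \<in> space ?P" using p sr by (auto simp: space_pair_measure)
      have m: "(if \<beta> = (e \<notin> C) then s e else r e) \<in> A (e, \<beta>)" if "e \<in> E" for e \<beta>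
      proof -
        have "?merge p (e, \<beta>) \<in> A (e, \<beta>)" using p that by (auto simp: PiE_def Pi_def)
        then show ?thesis using that by (auto simp: sr split: if_splits)
      qed
      have "s e \<in> ?A1 e" "r e \<in> ?A2 e" if "e \<in> E" for e
        using m[OF that, of "e \<notin> C"] m[OF that, of "e \<in> C"] by auto
      then show "p \<in> ?R" using sp sr by (auto simp: space_PiM PiE_def)
    next
      fix p assume p: "p \<in> ?R"
      obtain s r where sr: "p = (s, r)" by (cases p)
      have s: "s \<in> Pi\<^sub>E E ?A1" and r: "r \<in> Pi\<^sub>E E ?A2" using p sr by auto
      have sub: "?A1 e \<subseteq> space (D e)" "?A2 e \<subseteq> space (D e)" if "e \<in> E" for e
        using A'[OF that] sets.sets_into_space by blast+
      have "s \<in> space ?P" "r \<in> space ?P" unfolding space_PiM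
        using PiE_mono[of E ?A1 "\<lambda>e. space (D e)"] PiE_mono[of E ?A2 "\<lambda>e. space (D e)"] s r sub
        by blast+
      moreover have "?merge p (e, \<beta>) \<in> A (e, \<beta>)" if "e \<in> E" for e \<beta>
        using PiE_mem[OF s that] PiE_mem[OF r that] that sr by (cases \<beta>; cases "e \<in> C") auto
      ultimately show "p \<in> ?L" using sr by (auto simp: space_pair_measure PiE_iff)
    qed
    then have "emeasure (distr (?P \<Otimes>\<^sub>M ?P) ?Q ?merge) (Pi\<^sub>E (E \<times> UNIV) A)
        = emeasure (?P \<Otimes>\<^sub>M ?P) (Pi\<^sub>E E ?A1 \<times> Pi\<^sub>E E ?A2)"
      using A fin by (subst emeasure_distr[OF merge]) (auto intro!: sets_PiM_I_finite)
    also have "\<dots> = emeasure ?P (Pi\<^sub>E E ?A1) * emeasure ?P (Pi\<^sub>E E ?A2)"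
      using A' fin by (intro P.emeasure_pair_measure_Times sets_PiM_I_finite) auto
    also have "\<dots> = (\<Prod>e\<in>E. emeasure (D e) (?A1 e) * emeasure (D e) (?A2 e))"
      using A' fin by (simp add: D.emeasure_PiM prod.distrib)
    also have "\<dots> = (\<Prod>e\<in>E. \<Prod>\<beta>\<in>UNIV. emeasure (D e) (A (e, \<beta>)))"
    proof (intro prod.cong refl)
      fix e
      show "emeasure (D e) (?A1 e) * emeasure (D e) (?A2 e) = (\<Prod>\<beta>\<in>UNIV. emeasure (D e) (A (e, \<beta>)))"
        by (cases "e \<in> C") (simp_all add: UNIV_bool mult.commute)
    qed
    also have "\<dots> = (\<Prod>x\<in>E \<times> UNIV. emeasure (D (fst x)) (A x))"
      by (simp add: prod.cartesian_product case_prod_beta)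
    finally show "emeasure (distr (?P \<Otimes>\<^sub>M ?P) ?Q ?merge) (Pi\<^sub>E (E \<times> UNIV) A)
        = (\<Prod>x\<in>E \<times> UNIV. emeasure (D (fst x)) (A x))" .
  qed (use fin in auto)
  then have "distr ?Q (?P \<Otimes>\<^sub>M ?P) ?split = distr (distr (?P \<Otimes>\<^sub>M ?P) ?Q ?merge) (?P \<Otimes>\<^sub>M ?P) ?split"
    by simp
  also have "\<dots> = distr (?P \<Otimes>\<^sub>M ?P) (?P \<Otimes>\<^sub>M ?P) (?split \<circ> ?merge)"
    by (rule distr_distr[OF split merge])
  also have "\<dots> = distr (?P \<Otimes>\<^sub>M ?P) (?P \<Otimes>\<^sub>M ?P) (\<lambda>p. p)"
  \<comment> \<open>On the product space, whose points are undefined outside \<open>E\<close>,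
    splitting undoes merging.\<close>
  proof (intro distr_cong refl)
    fix p assume "p \<in> space (?P \<Otimes>\<^sub>M ?P)"
    then obtain s r where sr: "p = (s, r)" "s \<in> extensional E" "r \<in> extensional E"
      by (auto simp: space_pair_measure space_PiM PiE_def)
    show "(?split \<circ> ?merge) p = p"
      using sr(2,3) unfolding sr(1) by (auto simp: extensional_def fun_eq_iff)
  qed
  finally show ?thesis by simp
qed

text \<open>Coordinates outside \<open>E\<close> are included because the measurability results
  above quantify over all edges; there the evaluation is constant.\<close>

lemma measurable_PiM_apply:
  fixes D :: "'a \<Rightarrow> real measure"
  assumes "\<And>e. e \<in> E \<Longrightarrow> sets (D e) = sets borel"
  shows "(\<lambda>x. x e) \<in> borel_measurable (PiM E D)"
proof (cases "e \<in> E")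
  case True
  then show ?thesis
    using measurable_component_singleton[OF True, of D] measurable_cong_sets[OF refl assms[OF True]]
    by blast
next
  case False
  then have "x e = undefined" if "x \<in> space (PiM E D)" for x
    using that by (auto simp: space_PiM PiE_def extensional_def)
  then show ?thesis
    using measurable_cong[of "PiM E D" "\<lambda>x. x e" "\<lambda>_. undefined" borel] by simp
qed

lemma opt_nonneg:
  assumes "finite E"
  shows "0 \<le> opt E r"
proof -
  have "0 = weight r {}" by (simp add: weight_def)
  also have "\<dots> \<le> opt E r"
    unfolding opt_def using assms by (intro Max_ge) (auto simp: matching_def)
  finally show ?thesis .
qed

text \<open>For each coin set, the law of samples and rewards is the image of the law
  \<open>Q\<close> of two draws per edge. Summing over all coin sets moves both expectations to
  \<open>Q\<close>, where \<open>coin_average\<close> applies pointwise almost everywhere.\<close>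

lemma mechanism_competitive:
  fixes E :: "('b \<times> 'i) set" and D :: "'b \<times> 'i \<Rightarrow> real measure"
  assumes fin: "finite E" and prob: "\<And>e. prob_space (D e)" and sets: "\<And>e. sets (D e) = sets borel"
    and nonneg: "\<And>e. e \<in> E \<Longrightarrow> AE x in D e. 0 \<le> x"
    and atomless: "\<And>e x. e \<in> E \<Longrightarrow> measure (D e) {x} = 0"
    and sel: "\<forall>M A. A \<noteq> {} \<longrightarrow> sel M A \<in> A" and arr: "distinct arrivals" "fst ` E \<subseteq> set arrivals"
  shows "(\<integral>\<^sup>+(s, r, \<tau>). ennreal (opt E r) \<partial>joint_law E D) \<le>
    16 * (\<integral>\<^sup>+(s, r, \<tau>). ennreal (weight r (fst (mechanism sel E arrivals s \<tau> r))) \<partial>joint_law E D)"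
proof -
  define P where "P = PiM E D"
  define U where "U = uniform_count_measure (permutations_of_set E)"
  define Q where "Q = PiM (E \<times> (UNIV::bool set)) (\<lambda>x. D (fst x))"
  define W where "W s r \<tau> = ennreal (weight r (fst (mechanism sel E arrivals s \<tau> r)))" for s r \<tau>
  define V where "V r = ennreal (opt E r)" for r
  let ?split = "\<lambda>C \<omega>. (coin_sample E \<omega> C, coin_reward E \<omega> C)"
  have J: "joint_law E D = P \<Otimes>\<^sub>M (P \<Otimes>\<^sub>M U)" by (simp add: joint_law_def P_def U_def)
  interpret P: prob_space P unfolding P_def by (rule prob_space_PiM) (rule prob)
  interpret U: prob_space U unfolding U_def
    using fin by (intro prob_space_uniform_count_measure) auto
  interpret PU: prob_space "P \<Otimes>\<^sub>M U"
    by (intro prob_space_pair P.prob_space_axioms U.prob_space_axioms)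
  have spU: "space U = permutations_of_set E" "sets U = Pow (permutations_of_set E)"
    by (simp_all add: U_def space_uniform_count_measure sets_uniform_count_measure)
  have measU: "f \<in> borel_measurable U" for f :: "('b \<times> 'i) list \<Rightarrow> ennreal"
    by (simp add: measurable_def spU)
  have ev [measurable]: "(\<lambda>x. x e) \<in> borel_measurable P" for e
    unfolding P_def by (rule measurable_PiM_apply) (rule sets)
  have T: "simple_function (P \<Otimes>\<^sub>M (P \<Otimes>\<^sub>M U)) (\<lambda>\<omega>. snd (snd \<omega>))"
    unfolding simple_function_def
  proof (intro conjI ballI)
    have "(\<lambda>\<omega>. snd (snd \<omega>)) ` space (P \<Otimes>\<^sub>M (P \<Otimes>\<^sub>M U)) \<subseteq> permutations_of_set E"
      by (auto simp: space_pair_measure spU)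
    then show "finite ((\<lambda>\<omega>. snd (snd \<omega>)) ` space (P \<Otimes>\<^sub>M (P \<Otimes>\<^sub>M U)))"
      by (rule finite_subset) simp
  next
    fix \<tau> assume "\<tau> \<in> (\<lambda>\<omega>. snd (snd \<omega>)) ` space (P \<Otimes>\<^sub>M (P \<Otimes>\<^sub>M U))"
    then have "{\<tau>} \<in> sets U" by (auto simp: space_pair_measure spU)
    moreover have "(\<lambda>\<omega>. snd (snd \<omega>)) \<in> measurable (P \<Otimes>\<^sub>M (P \<Otimes>\<^sub>M U)) U" by measurable
    ultimately show "(\<lambda>\<omega>. snd (snd \<omega>)) -` {\<tau>} \<inter> space (P \<Otimes>\<^sub>M (P \<Otimes>\<^sub>M U)) \<in> sets (P \<Otimes>\<^sub>M (P \<Otimes>\<^sub>M U))"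
      by (rule measurable_sets[rotated])
  qed
  have W_meas: "(\<lambda>\<omega>. W (fst \<omega>) (fst (snd \<omega>)) (snd (snd \<omega>))) \<in> borel_measurable (P \<Otimes>\<^sub>M (P \<Otimes>\<^sub>M U))"
    unfolding W_def
    by (intro measurable_compose[OF _ measurable_ennreal] measurable_mechanism_weight T fin)
      measurable
  have O_meas: "V \<in> borel_measurable P"
    unfolding V_def
    by (intro measurable_compose[OF _ measurable_ennreal]
        measurable_opt[where S="\<lambda>r. r" and T="\<lambda>_. []"] fin) measurable
  \<comment> \<open>Integrating the enumeration first leaves a function of samples and rewards, to
    which the coupling applies.\<close>
  have fubini: "(\<integral>\<^sup>+\<omega>. f (fst \<omega>) (fst (snd \<omega>)) (snd (snd \<omega>)) \<partial>(P \<Otimes>\<^sub>M (P \<Otimes>\<^sub>M U)))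
      = (\<integral>\<^sup>+p. (\<integral>\<^sup>+\<tau>. f (fst p) (snd p) \<tau> \<partial>U) \<partial>(P \<Otimes>\<^sub>M P))"
    and fubini_meas: "(\<lambda>p. \<integral>\<^sup>+\<tau>. f (fst p) (snd p) \<tau> \<partial>U) \<in> borel_measurable (P \<Otimes>\<^sub>M P)"
    if f: "(\<lambda>\<omega>. f (fst \<omega>) (fst (snd \<omega>)) (snd (snd \<omega>))) \<in> borel_measurable (P \<Otimes>\<^sub>M (P \<Otimes>\<^sub>M U))"
    for f :: "('b \<times> 'i \<Rightarrow> real) \<Rightarrow> ('b \<times> 'i \<Rightarrow> real) \<Rightarrow> ('b \<times> 'i) list \<Rightarrow> ennreal"
  proof -
    have "(\<lambda>q. (fst (fst q), snd (fst q), snd q)) \<in> measurable ((P \<Otimes>\<^sub>M P) \<Otimes>\<^sub>M U) (P \<Otimes>\<^sub>M (P \<Otimes>\<^sub>M U))"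
      by measurable
    from measurable_compose[OF this f]
    have "(\<lambda>q. f (fst (fst q)) (snd (fst q)) (snd q)) \<in> borel_measurable ((P \<Otimes>\<^sub>M P) \<Otimes>\<^sub>M U)"
      by simp
    from U.borel_measurable_nn_integral_fst[OF this]
    show g: "(\<lambda>p. \<integral>\<^sup>+\<tau>. f (fst p) (snd p) \<tau> \<partial>U) \<in> borel_measurable (P \<Otimes>\<^sub>M P)" by simp
    have slice: "(\<lambda>q. f s (fst q) (snd q)) \<in> borel_measurable (P \<Otimes>\<^sub>M U)" if "s \<in> space P" for s
      using measurable_compose[OF measurable_Pair1'[OF that] f] by simp
    have "(\<integral>\<^sup>+\<omega>. f (fst \<omega>) (fst (snd \<omega>)) (snd (snd \<omega>)) \<partial>(P \<Otimes>\<^sub>M (P \<Otimes>\<^sub>M U)))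
      = (\<integral>\<^sup>+s. (\<integral>\<^sup>+q. f s (fst q) (snd q) \<partial>(P \<Otimes>\<^sub>M U)) \<partial>P)"
      by (subst PU.nn_integral_fst[OF f, symmetric]) simp
    also have "\<dots> = (\<integral>\<^sup>+s. (\<integral>\<^sup>+r. (\<integral>\<^sup>+\<tau>. f s r \<tau> \<partial>U) \<partial>P) \<partial>P)"
      by (intro nn_integral_cong) (simp add: U.nn_integral_fst[OF slice, symmetric])
    also have "\<dots> = (\<integral>\<^sup>+p. (\<integral>\<^sup>+\<tau>. f (fst p) (snd p) \<tau> \<partial>U) \<partial>(P \<Otimes>\<^sub>M P))"
      by (subst P.nn_integral_fst[OF g, symmetric]) simp
    finally show "(\<integral>\<^sup>+\<omega>. f (fst \<omega>) (fst (snd \<omega>)) (snd (snd \<omega>)) \<partial>(P \<Otimes>\<^sub>M (P \<Otimes>\<^sub>M U)))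
      = (\<integral>\<^sup>+p. (\<integral>\<^sup>+\<tau>. f (fst p) (snd p) \<tau> \<partial>U) \<partial>(P \<Otimes>\<^sub>M P))" .
  qed
  have comp: "(\<lambda>\<omega>. \<omega> (e, \<beta>)) \<in> measurable (PiM (E \<times> UNIV) (\<lambda>x. D (fst x))) (D e)"
    if "e \<in> E" for e and \<beta> :: bool
    using measurable_component_singleton[of "(e, \<beta>)" "E \<times> UNIV" "\<lambda>x. D (fst x)"] that by simp
  have split_meas: "?split C \<in> measurable Q (P \<Otimes>\<^sub>M P)" for C
    unfolding Q_def P_def coin_sample_def coin_reward_def
    by (intro measurable_Pair measurable_restrict comp)
  have coin: "(\<integral>\<^sup>+p. g p \<partial>(P \<Otimes>\<^sub>M P)) = (\<integral>\<^sup>+\<omega>. g (?split C \<omega>) \<partial>Q)"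
    if "g \<in> borel_measurable (P \<Otimes>\<^sub>M P)" for g C
  proof -
    have d: "distr Q (P \<Otimes>\<^sub>M P) (?split C) = P \<Otimes>\<^sub>M P"
      unfolding Q_def P_def coin_sample_def coin_reward_def
      by (rule distr_PiM_coin[OF fin prob])
    show ?thesis
      using nn_integral_distr[OF split_meas, of g C] that unfolding d by simp
  qed
  define Wbar where "Wbar p = (\<integral>\<^sup>+\<tau>. W (fst p) (snd p) \<tau> \<partial>U)" for p
  have Wbar_meas: "Wbar \<in> borel_measurable (P \<Otimes>\<^sub>M P)"
    unfolding Wbar_def by (rule fubini_meas[OF W_meas])
  have O2_meas: "(\<lambda>p. V (snd p)) \<in> borel_measurable (P \<Otimes>\<^sub>M P)"
    using O_meas by measurable
  have "AE \<omega> in Q. inj_on \<omega> (E \<times> UNIV)"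
    unfolding Q_def using fin prob sets atomless by (intro AE_PiM_inj_on) auto
  moreover have "AE \<omega> in Q. \<forall>x\<in>E \<times> UNIV. 0 \<le> \<omega> x"
    unfolding Q_def
  proof (rule AE_finite_allI)
    fix x :: "('b \<times> 'i) \<times> bool" assume x: "x \<in> E \<times> UNIV"
    then have "AE z in D (fst x). 0 \<le> z" by (intro nonneg) auto
    then show "AE \<omega> in PiM (E \<times> UNIV) (\<lambda>x. D (fst x)). 0 \<le> \<omega> x"
      using x prob by (intro AE_PiM_component) auto
  qed (use fin in simp)
  ultimately have key: "AE \<omega> in Q. (\<Sum>C\<in>Pow E. V (snd (?split C \<omega>))) \<le> 16 * (\<Sum>C\<in>Pow E. Wbar (?split C \<omega>))"
  proof eventually_elim
    case (elim \<omega>)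
    have "(\<Sum>C\<in>Pow E. V (coin_reward E \<omega> C)) = (\<integral>\<^sup>+\<tau>. (\<Sum>C\<in>Pow E. V (coin_reward E \<omega> C)) \<partial>U)"
      by (simp add: U.emeasure_space_1)
    \<comment> \<open>The bound holds for every single enumeration \<open>\<tau>\<close>, hence also
      after averaging.\<close>
    also have "\<dots> \<le> (\<integral>\<^sup>+\<tau>. 16 * (\<Sum>C\<in>Pow E. W (coin_sample E \<omega> C) (coin_reward E \<omega> C) \<tau>) \<partial>U)"
    proof (rule nn_integral_mono)
      fix \<tau> assume "\<tau> \<in> space U"
      then have \<tau>: "set \<tau> = E" by (simp add: spU permutations_of_setD)
      have w0: "0 \<le> weight (coin_reward E \<omega> C)
         (fst (mechanism sel E arrivals (coin_sample E \<omega> C) \<tau> (coin_reward E \<omega> C)))" for C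
        unfolding weight_def
      proof (rule sum_nonneg)
        fix e assume "e \<in> fst (mechanism sel E arrivals (coin_sample E \<omega> C) \<tau> (coin_reward E \<omega> C))"
        then have "e \<in> E" using mechanism_subset[OF fin _ arr(1)] sel by blast
        then show "0 \<le> coin_reward E \<omega> C e" using elim(2) by simp
      qed
      have "(\<Sum>C\<in>Pow E. opt E (coin_reward E \<omega> C)) \<le> 16 * (\<Sum>C\<in>Pow E. weight (coin_reward E \<omega> C)
         (fst (mechanism sel E arrivals (coin_sample E \<omega> C) \<tau> (coin_reward E \<omega> C))))"
        using elim by (intro coin_average[OF fin _ _ sel arr \<tau>]) auto
      then have "ennreal (\<Sum>C\<in>Pow E. opt E (coin_reward E \<omega> C)) \<le>
        ennreal (16 * (\<Sum>C\<in>Pow E. weight (coin_reward E \<omega> C)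
         (fst (mechanism sel E arrivals (coin_sample E \<omega> C) \<tau> (coin_reward E \<omega> C)))))"
        by (rule ennreal_leI)
      then show "(\<Sum>C\<in>Pow E. V (coin_reward E \<omega> C)) \<le>
        16 * (\<Sum>C\<in>Pow E. W (coin_sample E \<omega> C) (coin_reward E \<omega> C) \<tau>)"
        unfolding V_def W_def using w0 opt_nonneg[OF fin]
        by (simp add: ennreal_mult sum_nonneg)
    qed
    also have "\<dots> = 16 * (\<Sum>C\<in>Pow E. Wbar (?split C \<omega>))"
      by (simp add: nn_integral_cmult nn_integral_sum measU Wbar_def)
    finally show ?case by simp
  qed
  let ?n = "of_nat (card (Pow E)) :: ennreal"
  have "?n * (\<integral>\<^sup>+p. V (snd p) \<partial>(P \<Otimes>\<^sub>M P)) = (\<Sum>C\<in>Pow E. \<integral>\<^sup>+\<omega>. V (snd (?split C \<omega>)) \<partial>Q)"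
    by (simp only: coin[OF O2_meas, symmetric] sum_constant)
  also have "\<dots> = (\<integral>\<^sup>+\<omega>. (\<Sum>C\<in>Pow E. V (snd (?split C \<omega>))) \<partial>Q)"
    by (rule nn_integral_sum[symmetric]) (rule measurable_compose[OF split_meas O2_meas])
  also have "\<dots> \<le> (\<integral>\<^sup>+\<omega>. 16 * (\<Sum>C\<in>Pow E. Wbar (?split C \<omega>)) \<partial>Q)"
    using key by (rule nn_integral_mono_AE)
  also have "\<dots> = 16 * (\<Sum>C\<in>Pow E. \<integral>\<^sup>+\<omega>. Wbar (?split C \<omega>) \<partial>Q)"
    using measurable_compose[OF split_meas Wbar_meas]
    by (simp add: nn_integral_cmult nn_integral_sum)
  also have "\<dots> = 16 * (?n * (\<integral>\<^sup>+p. Wbar p \<partial>(P \<Otimes>\<^sub>M P)))"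
    by (simp only: coin[OF Wbar_meas, symmetric] sum_constant)
  also have "\<dots> = ?n * (16 * (\<integral>\<^sup>+p. Wbar p \<partial>(P \<Otimes>\<^sub>M P)))"
    by (simp only: mult.left_commute)
  \<comment> \<open>The number of coin sets is finite and nonzero and can be cancelled in
    \<open>ennreal\<close>.\<close>
  finally have "(\<integral>\<^sup>+p. V (snd p) \<partial>(P \<Otimes>\<^sub>M P)) \<le> 16 * (\<integral>\<^sup>+p. Wbar p \<partial>(P \<Otimes>\<^sub>M P))"
    by (rule ennreal_mult_le_mult_iff[THEN iffD1, rotated 2])
      (use fin in \<open>simp_all add: card_eq_0_iff Pow_not_empty del: card_Pow\<close>)
  moreover have "(\<integral>\<^sup>+(s, r, \<tau>). ennreal (opt E r) \<partial>joint_law E D) = (\<integral>\<^sup>+p. V (snd p) \<partial>(P \<Otimes>\<^sub>M P))"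
  proof -
    have "(\<lambda>\<omega>. V (fst (snd \<omega>))) \<in> borel_measurable (P \<Otimes>\<^sub>M (P \<Otimes>\<^sub>M U))"
      using O_meas by measurable
    note f = fubini[of "\<lambda>s r \<tau>. V r", OF this]
    have "(\<lambda>(s, r, \<tau>). ennreal (opt E r)) =
        (\<lambda>\<omega> :: ('b \<times> 'i \<Rightarrow> real) \<times> ('b \<times> 'i \<Rightarrow> real) \<times> ('b \<times> 'i) list. V (fst (snd \<omega>)))"
      by (auto simp: fun_eq_iff V_def)
    with f show ?thesis by (simp add: J U.emeasure_space_1)
  qed
  moreover have "(\<integral>\<^sup>+(s, r, \<tau>). ennreal (weight r (fst (mechanism sel E arrivals s \<tau> r))) \<partial>joint_law E D)
      = (\<integral>\<^sup>+p. Wbar p \<partial>(P \<Otimes>\<^sub>M P))"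
  proof -
    have "(\<lambda>(s, r, \<tau>). ennreal (weight r (fst (mechanism sel E arrivals s \<tau> r)))) =
        (\<lambda>\<omega>. W (fst \<omega>) (fst (snd \<omega>)) (snd (snd \<omega>)))"
      by (auto simp: fun_eq_iff W_def)
    with fubini[OF W_meas] show ?thesis by (simp add: J Wbar_def)
  qed
  ultimately show ?thesis by simp
qed

text \<open>Truthfulness is asserted for every fixed outcome of samples and enumeration, not merely
  in expectation. Expectations are nonnegative integrals, so an infinite expected optimum is
  covered; \<open>ennreal\<close> truncates only on a null set, as rewards are almost surely
  nonnegative.\<close>

theorem theorem3:
  fixes B :: "'b set" and I :: "'i set" and E :: "('b \<times> 'i) set"
    and D :: "'b \<times> 'i \<Rightarrow> real measure"
    and sel :: "('b \<times> 'i) set \<Rightarrow> ('b \<times> 'i) set \<Rightarrow> 'b \<times> 'i"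
    and arrivals :: "'b list"
  assumes "finite B" and "finite I" and "E \<subseteq> B \<times> I"
    and "\<And>e. e \<in> E \<Longrightarrow> prob_space (D e)"
    and "\<And>e. e \<in> E \<Longrightarrow> sets (D e) = sets borel"
    and "\<And>e. e \<in> E \<Longrightarrow> AE x in D e. 0 \<le> x"
    and "\<And>M A. A \<noteq> {} \<Longrightarrow> sel M A \<in> A"
    and "arrivals \<in> permutations_of_set B"
  shows "(\<forall>s \<tau>. (\<forall>e\<in>E. 0 \<le> s e) \<longrightarrow> \<tau> \<in> permutations_of_set E \<longrightarrow>
            truthful B E (mechanism sel E arrivals s \<tau>)) \<and>
         ((\<forall>e\<in>E. \<forall>x. measure (D e) {x} = 0) \<longrightarrow>
            16 * (\<integral>\<^sup>+(s, r, \<tau>). ennreal (weight r (fst (mechanism sel E arrivals s \<tau> r))) \<partial>joint_law E D)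
              \<ge> (\<integral>\<^sup>+(s, r, \<tau>). ennreal (opt E r) \<partial>joint_law E D))"
proof -
  have fin: "finite E" using assms(1-3) by (meson finite_SigmaI finite_subset)
  have arr: "set arrivals = B" "distinct arrivals" using assms(8) permutations_of_setD by blast+
  \<comment> \<open>Outside \<open>E\<close> the family is filled up with point masses at 0, so that
    every member is a probability measure on the reals; the product over \<open>E\<close> stays the
    same.\<close>
  define D' where "D' e = (if e \<in> E then D e else return borel 0)" for e
  have J: "joint_law E D = joint_law E D'"
    unfolding joint_law_def D'_def by (simp cong: PiM_cong)
  have "truthful B E (mechanism sel E arrivals s \<tau>)" for s \<tau>
    by (rule mechanism_truthful[OF fin assms(7) arr(2,1)])
  moreover have "(\<integral>\<^sup>+(s, r, \<tau>). ennreal (opt E r) \<partial>joint_law E D) \<le>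
    16 * (\<integral>\<^sup>+(s, r, \<tau>). ennreal (weight r (fst (mechanism sel E arrivals s \<tau> r))) \<partial>joint_law E D)"
    if atomless: "\<forall>e\<in>E. \<forall>x. measure (D e) {x} = 0"
    unfolding J
  proof (rule mechanism_competitive[OF fin])
    show "prob_space (D' e)" for e
      using assms(4) by (auto simp: D'_def intro: prob_space_return)
    show "sets (D' e) = sets borel" for e using assms(5) by (simp add: D'_def)
    show "AE x in D' e. 0 \<le> x" if "e \<in> E" for e
      using assms(6)[OF that] by (simp only: D'_def that if_True)
    show "measure (D' e) {x} = 0" if "e \<in> E" for e x using atomless that by (simp add: D'_def)
    show "\<forall>M A. A \<noteq> {} \<longrightarrow> sel M A \<in> A" using assms(7) by blast
    show "distinct arrivals" by (rule arr(2))
    show "fst ` E \<subseteq> set arrivals" using assms(3) arr(1) by auto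
  qed
  ultimately show ?thesis by blast
qed

end
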